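(* Let $K$ be a field of characteristic not equal to $2$ and let $V$ be an $m$-dimensional vector space over $K$ equipped with a non-degenerate symmetric bilinear form $\langle\cdot,\cdot\rangle$. Let $n$ be a positive integer with $n\le 3$ or $n\ge m+2$. Then there exists a non-zero polynomial $f\in K[V^n]$ such that every $n$-point configuration $(P_1,\ldots,P_n)\in V^n$ with $f(P_1,\ldots,P_n)\neq 0$ is reconstructible from distances.
   Context: $V^n$ is the direct sum of $n$ copies of $V$; an $n$-point configuration is an element $(P_1,\ldots,P_n)\in V^n$. $K[V^n]$ is the ring of polynomials on $V^n$, i.e. after choosing a basis of $V$ it is the polynomial ring $K[x_{i,k} : 1\le i\le n,\ 1\le k\le m]$, where $x_{i,k}$ stands for the $k$-th coordinate of the $i$-th point. The (squared) distances of $(P_1,\ldots,P_n)$ are $d_{i,j}=\langle P_i-P_j,P_i-P_j\rangle\in K$, and the distribution of distances is encoded by the polynomial $F_{P_1,\ldots,P_n}(X)=\prod_{1\le i<j\le n}(X-d_{i,j})\in K[X]$. $\mathrm{O}(V)\subseteq \mathrm{GL}(V)$ is the orthogonal group of the form, and $\mathrm{AO}(V)$ is the group of maps $V\to V$ generated by $\mathrm{O}(V)$ and all translations. A configuration $(P_1,\ldots,P_n)\in V^n$ is called reconstructible from distances if for every $(Q_1,\ldots,Q_n)\in V^n$ with $F_{Q_1,\ldots,Q_n}(X)=F_{P_1,\ldots,P_n}(X)$ there exist a permutation $\pi\in S_n$ and $g\in\mathrm{AO}(V)$ such that $g(P_{\pi(i)})=Q_i$ for all $i$. *)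

theory Defs
  imports
    "HOL-Library.Poly_Mapping"
    "HOL-Computational_Algebra.Polynomial"
    "HOL-Combinatorics.Permutations"
    "HOL-Algebra.Bij"
    "HOL-Algebra.Generated_Groups"
begin

text \<open>
  Throughout, V is the whole type \<open>'v\<close>, regarded as a vector space over \<open>'a\<close> by means of
  \<open>scale\<close>. An n-point configuration is a function \<open>P :: nat \<Rightarrow> 'v\<close>, of which only the values
  on \<open>{1..n}\<close> matter.
\<close>

definition symmetric_bilinear_form ::
    "('a::field \<Rightarrow> 'v::ab_group_add \<Rightarrow> 'v) \<Rightarrow> ('v \<Rightarrow> 'v \<Rightarrow> 'a) \<Rightarrow> bool"
  where "symmetric_bilinear_form scale form \<longleftrightarrow>
    (\<forall>x. Vector_Spaces.linear scale (*) (\<lambda>y. form x y)) \<and>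
    (\<forall>y. Vector_Spaces.linear scale (*) (\<lambda>x. form x y)) \<and>
    (\<forall>x y. form x y = form y x)"

definition nondegenerate_form :: "('v::zero \<Rightarrow> 'v \<Rightarrow> 'a::zero) \<Rightarrow> bool"
  where "nondegenerate_form form \<longleftrightarrow> (\<forall>x. (\<forall>y. form x y = 0) \<longrightarrow> x = 0)"

definition orthogonal_maps ::
    "('a::field \<Rightarrow> 'v::ab_group_add \<Rightarrow> 'v) \<Rightarrow> ('v \<Rightarrow> 'v \<Rightarrow> 'a) \<Rightarrow> ('v \<Rightarrow> 'v) set"
  where "orthogonal_maps scale form =
    {g. Vector_Spaces.linear scale scale g \<and> bij g \<and> (\<forall>x y. form (g x) (g y) = form x y)}"

definition affine_orthogonal_group ::
    "('a::field \<Rightarrow> 'v::ab_group_add \<Rightarrow> 'v) \<Rightarrow> ('v \<Rightarrow> 'v \<Rightarrow> 'a) \<Rightarrow> ('v \<Rightarrow> 'v) set"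
  where "affine_orthogonal_group scale form =
    generate (BijGroup UNIV) (orthogonal_maps scale form \<union> {\<lambda>x. x + t |t. True})"

definition sq_distance :: "('v::ab_group_add \<Rightarrow> 'v \<Rightarrow> 'a) \<Rightarrow> (nat \<Rightarrow> 'v) \<Rightarrow> nat \<Rightarrow> nat \<Rightarrow> 'a"
  where "sq_distance form P i j = form (P i - P j) (P i - P j)"

definition distance_poly ::
    "('v::ab_group_add \<Rightarrow> 'v \<Rightarrow> 'a::field) \<Rightarrow> nat \<Rightarrow> (nat \<Rightarrow> 'v) \<Rightarrow> 'a poly"
  where "distance_poly form n P =
    (\<Prod>(i, j) \<in> {(i, j). 1 \<le> i \<and> i < j \<and> j \<le> n}. [:- sq_distance form P i j, 1:])"

definition reconstructible ::
    "('a::field \<Rightarrow> 'v::ab_group_add \<Rightarrow> 'v) \<Rightarrow> ('v \<Rightarrow> 'v \<Rightarrow> 'a) \<Rightarrow> nat \<Rightarrow> (nat \<Rightarrow> 'v) \<Rightarrow> bool"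
  where "reconstructible scale form n P \<longleftrightarrow>
    (\<forall>Q. distance_poly form n Q = distance_poly form n P \<longrightarrow>
      (\<exists>\<pi> g. \<pi> permutes {1..n} \<and> g \<in> affine_orthogonal_group scale form \<and>
        (\<forall>i\<in>{1..n}. g (P (\<pi> i)) = Q i)))"

text \<open>
  Polynomials are formal objects: a finitely supported map from monomials (finitely supported
  exponent maps on the variables) to coefficients. Over a finite field a non-zero polynomial
  may vanish as a function.
\<close>

type_synonym ('x, 'a) mpoly = "('x \<Rightarrow>\<^sub>0 nat) \<Rightarrow>\<^sub>0 'a"

definition mpoly_vars :: "('x, 'a::zero) mpoly \<Rightarrow> 'x set"
  where "mpoly_vars f = (\<Union>m\<in>Poly_Mapping.keys f. Poly_Mapping.keys m)"

definition mpoly_eval :: "('x \<Rightarrow> 'a) \<Rightarrow> ('x, 'a::comm_semiring_1) mpoly \<Rightarrow> 'a"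
  where "mpoly_eval v f =
    (\<Sum>m\<in>Poly_Mapping.keys f. Poly_Mapping.lookup f m *
      (\<Prod>x\<in>Poly_Mapping.keys m. v x ^ Poly_Mapping.lookup m x))"

text \<open>
  The basis vectors themselves serve as the coordinate index: the variable \<open>(i, b)\<close> stands for
  the coordinate of the i-th point with respect to the basis vector \<open>b\<close>.
\<close>

definition configuration_polys :: "nat \<Rightarrow> 'v set \<Rightarrow> (nat \<times> 'v, 'a::zero) mpoly set"
  where "configuration_polys n B = {f. mpoly_vars f \<subseteq> {1..n} \<times> B}"

definition eval_at_configuration ::
    "('a::field \<Rightarrow> 'v::ab_group_add \<Rightarrow> 'v) \<Rightarrow> 'v set \<Rightarrow> (nat \<times> 'v, 'a) mpoly \<Rightarrow> (nat \<Rightarrow> 'v) \<Rightarrow> 'a"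
  where "eval_at_configuration scale B f P =
    mpoly_eval (\<lambda>(i, b). module.representation scale B (P i) b) f"

end

theory Submission
  imports Defs "Jordan_Normal_Form.Char_Poly"
begin

text \<open>
  Equality of the polynomials \<open>F\<close> of two configurations \<open>P\<close> and \<open>Q\<close> means that the distances of
  \<open>Q\<close> are the distances of \<open>P\<close> rearranged by a permutation \<open>\<phi>\<close> of the edges of the complete graph
  on \<open>{1..n}\<close>. For generic \<open>P\<close> two things have to be shown: \<open>\<phi>\<close> comes from a permutation of the
  points, and configurations with the same labelled distances are congruent. There are finitely many
  \<open>\<phi>\<close>, and over an infinite field finitely many polynomial functions, none identically zero, have a
  common point of non-vanishing (\<open>polyfun_common_nonzero\<close>). So one non-vanishing polynomial for each
  bad \<open>\<phi>\<close>, and one more for congruence, suffice; \<open>f\<close> is their product. Over a finite field the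
  statement is void in positive dimension: two distinct powers \<open>x^k\<close>, \<open>x^l\<close> agree as functions, so
  the non-zero polynomial \<open>x^k - x^l\<close> vanishes everywhere.

  Bad permutations are excluded by a rank. For a function \<open>D\<close> on edges consider the quadratic form
  \<open>\<Sum>\<^sub>i \<Sum>\<^sub>j D {i, j} h\<^sub>i h\<^sub>j\<close> on the hyperplane \<open>\<Sum> h\<^sub>i = 0\<close>. If \<open>D\<close> consists of the distances of a
  configuration \<open>Q\<close>, this is \<open>-2\<close> times the pull-back of the given form along \<open>h \<mapsto> \<Sum> h\<^sub>i Q\<^sub>i\<close>, so its
  rank is at most \<open>m\<close> (\<open>twisted_det_vanishes\<close>). If \<open>\<phi>\<close> is not induced by a permutation of the points,
  then it maps some triangle to three edges which do not form a triangle
  (\<open>triangle_preserving_induced\<close>). Some vertex \<open>v\<close> then lies on exactly one of these three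
  edges, and the configuration with \<open>P\<^sub>v = e \<noteq> 0\<close> and all other points \<open>0\<close> yields a rearranged distance
  function of rank at least \<open>2\<close>, although it lives in one dimension. Each further orthogonal
  direction \<open>u\<close> raises the rank by at least one more (\<open>twisted_rank_growth\<close>): moving the points by
  multiples \<open>s x\<^sub>i u\<close> adds \<open>s\<^sup>2 \<langle>u,u\<rangle> (x\<^sub>a - x\<^sub>b)\<^sup>2\<close> to the distances, and because such functions of
  the edge \<open>{a, b}\<close> span all functions on edges, for suitable \<open>x\<close> the added form does not vanish on a
  given vector of the orthogonal complement. All \<open>m\<close> directions together give rank at least \<open>m + 1\<close>,
  more than a configuration \<open>Q\<close> can have. The complement is non-zero as long as the current rank is less than
  \<open>n - 1\<close>, which is where \<open>n \<ge> m + 2\<close> enters; for \<open>n \<le> 3\<close> every \<open>\<phi>\<close> is induced by a permutation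
  of the points.

  Congruence is Witt's theorem. It is proved by reflections for lists of vectors
  whose successive orthogonalization meets no isotropic vector, a polynomial condition
  (\<open>witt_extension\<close>). The condition is imposed on the first \<open>min m (n - 1)\<close> difference vectors, and the
  remaining points are determined by their inner products with a basis
  (\<open>congruent_if_distances_equal\<close>).
\<close>

section \<open>Linear systems and perturbed determinants\<close>

text \<open>Padding with zero equations gives a square matrix of determinant zero, hence a kernel vector.\<close>
lemma underdetermined_system:
  fixes A :: "nat \<Rightarrow> nat \<Rightarrow> 'a::field"
  assumes "k < N"
  obtains c where "\<exists>i<N. c i \<noteq> 0" "\<And>r. r < k \<Longrightarrow> (\<Sum>i<N. A r i * c i) = 0"
proof -
  define M where "M = mat N N (\<lambda>(r, i). if r < k then A r i else 0)"
  have M: "M \<in> carrier_mat N N" by (simp add: M_def)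
  have "(\<Prod>i = 0..<N. M $$ (i, p i)) = 0" if "p permutes {0..<N}" for p
    using assms permutes_in_image[OF that, of k]
    by (intro prod_zero bexI[of _ k]) (auto simp: M_def)
  then have "det M = 0"
    unfolding det_def'[OF M] by (intro sum.neutral) simp
  then obtain v where v: "v \<in> carrier_vec N" "v \<noteq> 0\<^sub>v N" "M *\<^sub>v v = 0\<^sub>v N"
    using det_0_iff_vec_prod_zero_field[OF M] by blast
  show ?thesis
  proof
    show "\<exists>i<N. v $ i \<noteq> 0"
      using v(1,2) by (metis carrier_vecD dim_vec eq_vecI index_zero_vec)
    show "(\<Sum>i<N. A r i * v $ i) = 0" if "r < k" for r
    proof -
      have "(M *\<^sub>v v) $ r = 0" using v(3) that assms by simp
      then show ?thesis
        using that assms v(1) M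
        by (simp add: M_def scalar_prod_def atLeast0LessThan)
    qed
  qed
qed

lemma det_last_column_zero:
  fixes A :: "nat \<Rightarrow> nat \<Rightarrow> 'a::field"
  assumes "\<And>i. i < k \<Longrightarrow> A i k = 0"
  shows "det (mat (Suc k) (Suc k) (\<lambda>(i, j). A i j)) = det (mat k k (\<lambda>(i, j). A i j)) * A k k"
proof -
  have "mat (Suc k) (Suc k) (\<lambda>(i, j). A i j) =
      four_block_mat (mat k k (\<lambda>(i, j). A i j)) (0\<^sub>m k 1)
        (mat 1 k (\<lambda>(i, j). A k j)) (mat 1 1 (\<lambda>_. A k k))"
    using assms by (intro eq_matI) (auto simp: less_Suc_eq)
  also have "det \<dots> = det (mat k k (\<lambda>(i, j). A i j)) * det (mat 1 1 (\<lambda>_. A k k))"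
    by (rule det_four_block_mat_upper_right_zero_col) auto
  finally show ?thesis
    by (simp add: det_single)
qed

text \<open>
  This is the step that raises a rank. If \<open>A k k \<noteq> 0\<close>, then \<open>s = 0\<close> will do. Otherwise a factor \<open>s\<^sup>2\<close> can
  be taken out of the last row, and the remaining determinant is a polynomial in \<open>s\<close> whose value at \<open>0\<close>
  is the regular \<open>k \<times> k\<close> minor of \<open>A\<close> times \<open>C k k\<close>, so only finitely many \<open>s\<close> are bad. The
  parameter enters as a square because distances are quadratic in the points.
\<close>
lemma det_perturbation_nonzero:
  fixes A C :: "nat \<Rightarrow> nat \<Rightarrow> 'a::field"
  assumes inf: "infinite (UNIV :: 'a set)"
    and A0: "det (mat k k (\<lambda>(i, j). A i j)) \<noteq> 0"
    and Acol: "\<And>i. i < k \<Longrightarrow> A i k = 0"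
    and Arow: "\<And>j. j < k \<Longrightarrow> A k j = 0"
    and C: "A k k = 0 \<Longrightarrow> C k k \<noteq> 0"
  obtains s where "det (mat (Suc k) (Suc k) (\<lambda>(i, j). A i j + s\<^sup>2 * C i j)) \<noteq> 0"
proof (cases "A k k = 0")
  case False
  then show ?thesis
    using that[of 0] det_last_column_zero[of k A] A0 Acol by simp
next
  case True
  let ?N = "\<lambda>s. mat (Suc k) (Suc k) (\<lambda>(i, j). if i < k then A i j + s\<^sup>2 * C i j else C k j)"
  \<comment> \<open>The matrix after division of the last row by \<open>s\<^sup>2\<close>, with \<open>s\<close> as the indeterminate.\<close>
  define Mp where "Mp = mat (Suc k) (Suc k)
    (\<lambda>(i, j). if i < k then [:A i j:] + monom (C i j) 2 else [:C k j:])"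
  have Mp: "poly (det Mp) s = det (?N s)" for s
    by (rule poly_det_cong[of _ "Suc k"]) (auto simp: Mp_def poly_monom algebra_simps)
  have "det (?N 0) = det (mat k k (\<lambda>(i, j). A i j)) * C k k"
  proof -
    have "det (mat (Suc k) (Suc k) (\<lambda>(i, j). (if i < k then A i j else C k j))) =
        det (mat k k (\<lambda>(i, j). (if i < k then A i j else C k j))) * C k k"
      by (subst det_last_column_zero) (auto simp: Acol)
    also have "mat k k (\<lambda>(i, j). (if i < k then A i j else C k j)) = mat k k (\<lambda>(i, j). A i j)"
      by (intro eq_matI) auto
    also have "mat (Suc k) (Suc k) (\<lambda>(i, j). (if i < k then A i j else C k j)) = ?N 0"
      by (intro eq_matI) auto
    finally show ?thesis .
  qed
  then have "poly (det Mp) 0 \<noteq> 0"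
    using A0 C[OF True] by (simp add: Mp)
  then have "det Mp \<noteq> 0" by auto
  then have "finite (insert 0 {s. poly (det Mp) s = 0})"
    by (simp add: poly_roots_finite)
  then obtain s where s: "s \<notin> insert 0 {s. poly (det Mp) s = 0}"
    using inf by (metis ex_new_if_finite)
  have "mat (Suc k) (Suc k) (\<lambda>(i, j). A i j + s\<^sup>2 * C i j) = multrow k (s\<^sup>2) (?N s)"
    using True Arow by (intro eq_matI) (auto simp: less_Suc_eq)
  then have "det (mat (Suc k) (Suc k) (\<lambda>(i, j). A i j + s\<^sup>2 * C i j)) = s\<^sup>2 * det (?N s)"
    by (simp add: det_multrow[of _ "Suc k"])
  moreover have "s\<^sup>2 * det (?N s) \<noteq> 0"
    using s by (simp add: Mp)
  ultimately show ?thesis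
    using that by metis
qed

section \<open>Evaluation of formal polynomials\<close>

text \<open>
  Evaluation is defined by a sum over the support, which makes multiplicativity awkward to prove
  directly; induction over sums of monomials reduces it to two monomials.
\<close>
lemma mpoly_induct:
  fixes f :: "('x, 'a::comm_monoid_add) mpoly"
  assumes "Q 0" "\<And>m c. Q (Poly_Mapping.single m c)" "\<And>f g. Q f \<Longrightarrow> Q g \<Longrightarrow> Q (f + g)"
  shows "Q f"
proof (induction f rule: update_induct)
  case const
  show ?case by fact
next
  case (update f a b)
  have "Poly_Mapping.update a b f = f + Poly_Mapping.single a b"
    using update(1)
    by (intro poly_mapping_eqI)
       (auto simp: lookup_update lookup_add lookup_single in_keys_iff)
  with update assms show ?case by simp
qed

definition monomial_eval :: "('x \<Rightarrow> 'a::comm_semiring_1) \<Rightarrow> ('x \<Rightarrow>\<^sub>0 nat) \<Rightarrow> 'a"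
  where "monomial_eval v m = (\<Prod>x\<in>Poly_Mapping.keys m. v x ^ Poly_Mapping.lookup m x)"

lemma monomial_eval_superset:
  assumes "finite S" "Poly_Mapping.keys m \<subseteq> S"
  shows "monomial_eval v m = (\<Prod>x\<in>S. v x ^ Poly_Mapping.lookup m x)"
  unfolding monomial_eval_def using assms
  by (intro prod.mono_neutral_left) (auto simp: in_keys_iff)

lemma monomial_eval_add: "monomial_eval v (m + m') = monomial_eval v m * monomial_eval v m'"
proof -
  let ?S = "Poly_Mapping.keys m \<union> Poly_Mapping.keys m'"
  have "monomial_eval v (m + m') = (\<Prod>x\<in>?S. v x ^ Poly_Mapping.lookup (m + m') x)"
    by (intro monomial_eval_superset) (auto dest: subsetD[OF keys_add])
  also have "\<dots> = monomial_eval v m * monomial_eval v m'"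
    by (subst (1 2) monomial_eval_superset[of ?S])
       (auto simp: lookup_add power_add prod.distrib)
  finally show ?thesis .
qed

lemma mpoly_eval_superset:
  assumes "finite S" "Poly_Mapping.keys f \<subseteq> S"
  shows "mpoly_eval v f = (\<Sum>m\<in>S. Poly_Mapping.lookup f m * monomial_eval v m)"
  unfolding mpoly_eval_def monomial_eval_def[symmetric] using assms
  by (intro sum.mono_neutral_left) (auto simp: in_keys_iff)

lemma mpoly_eval_single:
  "mpoly_eval v (Poly_Mapping.single m c) = c * monomial_eval v m"
  by (subst mpoly_eval_superset[of "{m}"]) (auto simp: keys_single)

lemma mpoly_eval_add: "mpoly_eval v (f + g) = mpoly_eval v f + mpoly_eval v g"
proof -
  let ?S = "Poly_Mapping.keys f \<union> Poly_Mapping.keys g"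
  have "mpoly_eval v (f + g) = (\<Sum>m\<in>?S. Poly_Mapping.lookup (f + g) m * monomial_eval v m)"
    by (intro mpoly_eval_superset) (auto dest: subsetD[OF keys_add])
  also have "\<dots> = mpoly_eval v f + mpoly_eval v g"
    by (subst (1 2) mpoly_eval_superset[of ?S])
       (auto simp: lookup_add algebra_simps sum.distrib)
  finally show ?thesis .
qed

lemma mpoly_eval_0 [simp]: "mpoly_eval v 0 = 0"
  by (simp add: mpoly_eval_def)

lemma mpoly_eval_mult: "mpoly_eval v (f * g) = mpoly_eval v f * mpoly_eval v g"
proof (induction f rule: mpoly_induct)
  case (2 m c)
  show ?case
  proof (induction g rule: mpoly_induct)
    case (2 m' c')
    show ?case
      by (simp add: mult_single mpoly_eval_single monomial_eval_add ac_simps)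
  qed (auto simp: mpoly_eval_add algebra_simps)
qed (auto simp: mpoly_eval_add algebra_simps)

lemma mpoly_vars_add: "mpoly_vars (f + g) \<subseteq> mpoly_vars f \<union> mpoly_vars g"
  using keys_add[of f g] by (auto simp: mpoly_vars_def)

lemma mpoly_vars_mult: "mpoly_vars (f * g) \<subseteq> mpoly_vars f \<union> mpoly_vars g"
proof
  fix x assume "x \<in> mpoly_vars (f * g)"
  then obtain m m' where "m \<in> Poly_Mapping.keys f" "m' \<in> Poly_Mapping.keys g"
      "x \<in> Poly_Mapping.keys (m + m')"
    using keys_mult[of f g] unfolding mpoly_vars_def by blast
  then show "x \<in> mpoly_vars f \<union> mpoly_vars g"
    using keys_add[of m m'] by (auto simp: mpoly_vars_def)
qed

section \<open>Non-degenerate symmetric bilinear forms\<close>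

locale quadratic_space = finite_dimensional_vector_space scale Basis
  for scale :: "'a::field \<Rightarrow> 'v::ab_group_add \<Rightarrow> 'v" (infixr "*s" 75) and Basis :: "'v set" +
  fixes form :: "'v \<Rightarrow> 'v \<Rightarrow> 'a"
  assumes bilinear: "symmetric_bilinear_form scale form"
    and nondegenerate: "nondegenerate_form form"
    and two_nonzero: "(2::'a) \<noteq> 0"
begin

lemma form_sym: "form x y = form y x"
  using bilinear by (simp add: symmetric_bilinear_form_def)

lemma form_add_right: "form x (y + z) = form x y + form x z"
  and form_scale_right: "form x (c *s y) = c * form x y"
  using bilinear by (auto simp: symmetric_bilinear_form_def Vector_Spaces.linear_iff)

lemma form_add_left: "form (y + z) x = form y x + form z x"
  and form_scale_left: "form (c *s y) x = c * form y x"
  by (simp_all add: form_sym[of _ x] form_add_right form_scale_right)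

lemma form_zero_right [simp]: "form x 0 = 0"
  using form_add_right[of x 0 0] by (metis add_0 add_cancel_right_right)

lemma form_zero_left [simp]: "form 0 x = 0"
  by (simp add: form_sym[of 0])

lemma form_minus_right: "form x (- y) = - form x y"
  using form_add_right[of x y "- y"] by (simp add: minus_unique)

lemma form_minus_left: "form (- y) x = - form y x"
  by (simp add: form_sym[of _ x] form_minus_right)

lemma form_diff_right: "form x (y - z) = form x y - form x z"
  using form_add_right[of x y "- z"] by (simp add: form_minus_right)

lemma form_diff_left: "form (y - z) x = form y x - form z x"
  by (simp add: form_sym[of _ x] form_diff_right)

lemma form_sum_right: "form x (\<Sum>i\<in>I. f i) = (\<Sum>i\<in>I. form x (f i))"
  by (induction I rule: infinite_finite_induct) (auto simp: form_add_right)

lemma form_sum_left: "form (\<Sum>i\<in>I. f i) x = (\<Sum>i\<in>I. form (f i) x)"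
  by (simp add: form_sym[of _ x] form_sum_right)

lemmas form_simps = form_add_left form_add_right form_diff_left form_diff_right
  form_scale_left form_scale_right form_minus_left form_minus_right

abbreviation coord :: "'v \<Rightarrow> 'v \<Rightarrow> 'a"
  where "coord x b \<equiv> representation Basis x b"

lemma coord_add: "coord (x + y) b = coord x b + coord y b"
  and coord_diff: "coord (x - y) b = coord x b - coord y b"
  and coord_scale: "coord (c *s x) b = c * coord x b"
  by (simp_all add: representation_add representation_diff representation_scale
      independent_Basis span_Basis)

lemma sum_coord: "(\<Sum>b\<in>Basis. coord x b *s b) = x"
  by (rule sum_representation_eq) (auto simp: independent_Basis span_Basis finite_Basis)

section \<open>Polynomial functions of a configuration\<close>

text \<open>
  Over an infinite field only the functions defined by polynomials matter, so the argument works
  with the algebra of functions generated by the coordinates, which is closed under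
  the constructions below; \<open>polyfun_eq_eval\<close> returns to formal polynomials.
\<close>
inductive polyfun :: "nat \<Rightarrow> ((nat \<Rightarrow> 'v) \<Rightarrow> 'a) \<Rightarrow> bool" for n where
  const: "polyfun n (\<lambda>P. c)"
| coord: "i \<in> {1..n} \<Longrightarrow> b \<in> Basis \<Longrightarrow> polyfun n (\<lambda>P. coord (P i) b)"
| add: "polyfun n F \<Longrightarrow> polyfun n G \<Longrightarrow> polyfun n (\<lambda>P. F P + G P)"
| mult: "polyfun n F \<Longrightarrow> polyfun n G \<Longrightarrow> polyfun n (\<lambda>P. F P * G P)"

lemma polyfun_sum: "(\<And>i. i \<in> I \<Longrightarrow> polyfun n (F i)) \<Longrightarrow> polyfun n (\<lambda>P. \<Sum>i\<in>I. F i P)"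
  by (induction I rule: infinite_finite_induct) (auto intro: polyfun.intros)

lemma polyfun_prod: "(\<And>i. i \<in> I \<Longrightarrow> polyfun n (F i)) \<Longrightarrow> polyfun n (\<lambda>P. \<Prod>i\<in>I. F i P)"
  by (induction I rule: infinite_finite_induct) (auto intro: polyfun.intros)

lemma polyfun_diff:
  assumes "polyfun n F" "polyfun n G"
  shows "polyfun n (\<lambda>P. F P - G P)"
  using polyfun.add[OF assms(1) polyfun.mult[OF polyfun.const[of n "-1"] assms(2)]] by simp

lemma polyfun_det:
  assumes "\<And>i j. i < k \<Longrightarrow> j < k \<Longrightarrow> polyfun n (F i j)"
  shows "polyfun n (\<lambda>P. det (mat k k (\<lambda>(i, j). F i j P)))"
proof -
  have less: "p i < k" if "p permutes {0..<k}" "i < k" for p i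
    using permutes_in_image[OF that(1), of i] that(2) by simp
  have "det (mat k k (\<lambda>(i, j). F i j P)) =
      (\<Sum>p\<in>{p. p permutes {0..<k}}. signof p * (\<Prod>i = 0..<k. F i (p i) P))" for P
    unfolding det_def'[OF mat_carrier] by (intro sum.cong refl arg_cong2[of _ _ _ _ "(*)"] prod.cong)
      (simp add: less)
  moreover have "polyfun n (\<lambda>P. \<Sum>p\<in>{p. p permutes {0..<k}}.
      signof p * (\<Prod>i = 0..<k. F i (p i) P))"
    by (intro polyfun_sum polyfun.mult polyfun.const polyfun_prod assms) (simp_all add: less)
  ultimately show ?thesis by simp
qed

definition polyvec :: "nat \<Rightarrow> ((nat \<Rightarrow> 'v) \<Rightarrow> 'v) \<Rightarrow> bool"
  where "polyvec n X \<longleftrightarrow> (\<forall>b\<in>Basis. polyfun n (\<lambda>P. coord (X P) b))"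

lemma polyvec_point: "i \<in> {1..n} \<Longrightarrow> polyvec n (\<lambda>P. P i)"
  by (simp add: polyvec_def polyfun.coord)

lemma polyvec_diff: "polyvec n X \<Longrightarrow> polyvec n Y \<Longrightarrow> polyvec n (\<lambda>P. X P - Y P)"
  by (simp add: polyvec_def coord_diff polyfun_diff)

lemma polyvec_scale: "polyfun n F \<Longrightarrow> polyvec n X \<Longrightarrow> polyvec n (\<lambda>P. F P *s X P)"
  by (simp add: polyvec_def coord_scale polyfun.mult)

lemma polyfun_form:
  assumes "polyvec n X" "polyvec n Y"
  shows "polyfun n (\<lambda>P. form (X P) (Y P))"
proof -
  have "form x y = (\<Sum>b\<in>Basis. \<Sum>c\<in>Basis. coord x b * (coord y c * form b c))" for x y
  proof -
    have "form x y = form (\<Sum>b\<in>Basis. coord x b *s b) (\<Sum>c\<in>Basis. coord y c *s c)"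
      by (simp only: sum_coord)
    also have "\<dots> = (\<Sum>b\<in>Basis. form (coord x b *s b) (\<Sum>c\<in>Basis. coord y c *s c))"
      by (rule form_sum_left)
    finally show ?thesis
      by (simp add: form_sum_left form_sum_right form_scale_left form_scale_right sum_distrib_left mult.left_commute)
  qed
  then have eq: "(\<lambda>P. form (X P) (Y P)) =
      (\<lambda>P. \<Sum>b\<in>Basis. \<Sum>c\<in>Basis. coord (X P) b * (coord (Y P) c * form b c))"
    by (intro ext)
  show ?thesis
    unfolding eq
    using assms by (intro polyfun_sum polyfun.mult polyfun.const) (auto simp: polyvec_def)
qed

text \<open>This reduces questions about zeros in many variables to univariate polynomials.\<close>
lemma polyfun_on_line:
  assumes "polyfun n F"
  shows "\<exists>p. \<forall>t. poly p t = F (\<lambda>i. P i + t *s R i)"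
  using assms
proof induction
  case (const c)
  show ?case by (intro exI[of _ "[:c:]"]) simp
next
  case (coord i b)
  show ?case
    by (intro exI[of _ "[:coord (P i) b, coord (R i) b:]"]) (simp add: coord_add coord_scale)
next
  case (add F G)
  then show ?case by (metis poly_add)
next
  case (mult F G)
  then show ?case by (metis poly_mult)
qed

text \<open>
  On the line through a point where the first functions are non-zero and a point where the next one is
  non-zero, all of them are non-zero univariate polynomials.
\<close>
lemma polyfun_common_nonzero:
  assumes inf: "infinite (UNIV :: 'a set)" and "finite I"
    and "\<And>i. i \<in> I \<Longrightarrow> polyfun n (F i)" "\<And>i. i \<in> I \<Longrightarrow> \<exists>P. F i P \<noteq> 0"
  shows "\<exists>P. \<forall>i\<in>I. F i P \<noteq> 0"
  using assms(2-)
proof (induction I rule: finite_induct)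
  case (insert j I)
  obtain P where P: "\<forall>i\<in>I. F i P \<noteq> 0"
    using insert by auto
  obtain R where R: "F j R \<noteq> 0"
    using insert by blast
  have G: "polyfun n (\<lambda>P. \<Prod>i\<in>I. F i P)"
    using insert by (intro polyfun_prod) auto
  obtain p where p: "poly p t = (\<Prod>i\<in>I. F i (\<lambda>l. P l + t *s (R l - P l)))" for t
    using polyfun_on_line[OF G, of P "\<lambda>l. R l - P l"] by auto
  obtain q where q: "poly q t = F j (\<lambda>l. P l + t *s (R l - P l))" for t
    using polyfun_on_line[of n "F j" P "\<lambda>l. R l - P l"] insert by auto
  have "poly p 0 \<noteq> 0" "poly q 1 \<noteq> 0"
    using P R insert(1) by (auto simp: p q)
  then have "p * q \<noteq> 0" by auto
  then obtain t where "poly (p * q) t \<noteq> 0"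
    using inf poly_roots_finite[of "p * q"] by (metis (mono_tags, lifting) ex_new_if_finite mem_Collect_eq)
  then show ?case
    using insert(1) by (intro exI[of _ "\<lambda>l. P l + t *s (R l - P l)"]) (auto simp: p q)
qed auto

lemma polyfun_eq_eval:
  assumes "polyfun n F"
  shows "\<exists>f \<in> configuration_polys n Basis. \<forall>P. eval_at_configuration scale Basis f P = F P"
  using assms
proof induction
  case (const c)
  show ?case
    by (intro bexI[of _ "Poly_Mapping.single 0 c"])
       (auto simp: eval_at_configuration_def mpoly_eval_single monomial_eval_def
         configuration_polys_def mpoly_vars_def split: if_splits)
next
  case (coord i b)
  then show ?case
    by (intro bexI[of _ "Poly_Mapping.single (Poly_Mapping.single (i, b) 1) 1"])
       (auto simp: eval_at_configuration_def mpoly_eval_single monomial_eval_def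
         configuration_polys_def mpoly_vars_def split: if_splits)
next
  case (add F G)
  then obtain f g where "f \<in> configuration_polys n Basis" "g \<in> configuration_polys n Basis"
    "\<forall>P. eval_at_configuration scale Basis f P = F P"
    "\<forall>P. eval_at_configuration scale Basis g P = G P" by auto
  then show ?case
    using mpoly_vars_add[of f g]
    by (intro bexI[of _ "f + g"])
       (auto simp: eval_at_configuration_def configuration_polys_def mpoly_eval_add)
next
  case (mult F G)
  then obtain f g where "f \<in> configuration_polys n Basis" "g \<in> configuration_polys n Basis"
    "\<forall>P. eval_at_configuration scale Basis f P = F P"
    "\<forall>P. eval_at_configuration scale Basis g P = G P" by auto
  then show ?case
    using mpoly_vars_mult[of f g]
    by (intro bexI[of _ "f * g"])
       (auto simp: eval_at_configuration_def configuration_polys_def mpoly_eval_mult)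
qed

end

section \<open>Reflections and the theorem of Witt\<close>

context quadratic_space
begin

lemma orthogonal_maps_iff:
  "g \<in> orthogonal_maps scale form \<longleftrightarrow>
    (\<forall>x y. g (x + y) = g x + g y) \<and> (\<forall>c x. g (c *s x) = c *s g x) \<and> bij g \<and>
    (\<forall>x y. form (g x) (g y) = form x y)"
  using vector_space_axioms by (auto simp: orthogonal_maps_def Vector_Spaces.linear_iff)

lemma orthogonal_maps_comp:
  "g \<in> orthogonal_maps scale form \<Longrightarrow> h \<in> orthogonal_maps scale form \<Longrightarrow>
    g \<circ> h \<in> orthogonal_maps scale form"
  by (auto simp: orthogonal_maps_iff bij_comp)

lemma orthogonal_maps_inv:
  assumes "g \<in> orthogonal_maps scale form"
  shows "inv_into UNIV g \<in> orthogonal_maps scale form"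
proof -
  note g = assms[unfolded orthogonal_maps_iff]
  have gi: "g (inv_into UNIV g x) = x" for x
    using g by (simp add: bij_is_surj surj_f_inv_f)
  have eqI: "x = y" if "g x = g y" for x y
    using g that by (simp add: bij_is_inj inj_eq)
  show ?thesis
    unfolding orthogonal_maps_iff
  proof (intro conjI allI)
    show "inv_into UNIV g (x + y) = inv_into UNIV g x + inv_into UNIV g y" for x y
      by (rule eqI) (use g in \<open>simp add: gi\<close>)
    show "inv_into UNIV g (c *s x) = c *s inv_into UNIV g x" for c x
      by (rule eqI) (use g in \<open>simp add: gi\<close>)
    show "bij (inv_into UNIV g)" using g by (simp add: bij_imp_bij_inv)
    show "form (inv_into UNIV g x) (inv_into UNIV g y) = form x y" for x y
      using g gi by metis
  qed
qed

lemma id_orthogonal: "(\<lambda>x. x) \<in> orthogonal_maps scale form"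
  by (simp add: orthogonal_maps_iff bij_id[unfolded id_def])

definition reflection :: "'v \<Rightarrow> 'v \<Rightarrow> 'v"
  where "reflection u x = x - (2 * form x u / form u u) *s u"

lemma reflection_orthogonal:
  assumes "form u u \<noteq> 0"
  shows "reflection u \<in> orthogonal_maps scale form"
proof -
  have "reflection u (reflection u x) = x" for x
    using assms
    by (simp add: reflection_def form_simps field_simps flip: scale_left_distrib scale_minus_left)
  then have "bij (reflection u)"
    by (intro o_bij[of "reflection u"]) auto
  moreover have "form (reflection u x) (reflection u y) = form x y" for x y
    using assms by (simp add: reflection_def form_simps form_sym field_simps)
  ultimately show ?thesis
    unfolding orthogonal_maps_iff
    by (auto simp: reflection_def form_simps algebra_simps add_divide_distrib)
qed

lemma reflection_fixes: "form z u = 0 \<Longrightarrow> reflection u z = z"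
  by (simp add: reflection_def)

text \<open>
  If \<open>\<langle>v,v\<rangle> = \<langle>w,w\<rangle> \<noteq> 0\<close>, then \<open>v - w\<close> and \<open>v + w\<close> are not both isotropic, because their norms add up
  to \<open>4 \<langle>w,w\<rangle>\<close>. Reflection in \<open>v - w\<close> takes \<open>v\<close> to \<open>w\<close>; reflection in \<open>v + w\<close> takes it to \<open>-w\<close>, which
  the reflection in \<open>w\<close> corrects. All these reflections fix the orthogonal complement of \<open>v\<close> and \<open>w\<close>.
\<close>
lemma isometry_moving_vector:
  assumes vw: "form v v = form w w" and nz: "form w w \<noteq> 0"
  shows "\<exists>g \<in> orthogonal_maps scale form. g v = w \<and>
    (\<forall>z. form z v = 0 \<longrightarrow> form z w = 0 \<longrightarrow> g z = z)"
proof (cases "form (v - w) (v - w) = 0")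
  case False
  have "form (v - w) (v - w) = 2 * form v (v - w)"
    using vw by (simp add: form_simps form_sym)
  with False have "reflection (v - w) v = w"
    by (simp add: reflection_def)
  with False show ?thesis
    by (intro bexI[of _ "reflection (v - w)"])
       (auto simp: reflection_orthogonal reflection_fixes form_simps)
next
  case True
  then have "2 * (form w w - form v w) = 0"
    using vw by (simp add: form_simps form_sym algebra_simps)
  then have eq: "form v w = form w w"
    using two_nonzero by simp
  have e1: "form v (v + w) = 2 * form w w" and e2: "form (v + w) (v + w) = 2 * 2 * form w w"
    using vw eq by (simp_all add: form_simps form_sym)
  have nz': "form (v + w) (v + w) \<noteq> 0"
    using two_nonzero nz unfolding e2 by (metis mult_eq_0_iff)
  have "2 * form v (v + w) / form (v + w) (v + w) = 1"
    using nz' e1 e2 by (simp add: divide_eq_1_iff)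
  then have "reflection (v + w) v = - w"
    by (simp add: reflection_def)
  moreover have "reflection w (- w) = w"
    using nz scale_left_distrib[of 1 1 w] by (simp add: reflection_def form_simps)
  ultimately show ?thesis
    using nz nz'
    by (intro bexI[of _ "reflection w \<circ> reflection (v + w)"])
       (auto simp: reflection_orthogonal orthogonal_maps_comp reflection_fixes form_simps)
qed

text \<open>
  The Gram-Schmidt step that makes \<open>x\<close> orthogonal to \<open>v\<close>, multiplied by \<open>\<langle>v,v\<rangle>\<close> so that it
  stays polynomial in \<open>v\<close> and \<open>x\<close>.
\<close>
definition deflate :: "'v \<Rightarrow> 'v \<Rightarrow> 'v"
  where "deflate v x = form v v *s x - form x v *s v"

lemma form_deflate_left [simp]: "form (deflate v x) v = 0"
  and form_deflate_right [simp]: "form v (deflate v x) = 0"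
  by (simp_all add: deflate_def form_simps form_sym)

text \<open>
  The product of the norms met in the fraction-free Gram-Schmidt process. It plays the role of the
  product of the leading Gram minors, but is defined by the recursion that the proofs follow.
\<close>
fun orth_minor :: "'v list \<Rightarrow> 'a" where
  "orth_minor [] = 1"
| "orth_minor (v # vs) = form v v * orth_minor (map (deflate v) vs)"

text \<open>
  Witt's theorem for lists. An isometry \<open>h\<close> first moves the head \<open>w\<close> of the second list to the head
  \<open>v\<close> of the first one; the induction hypothesis then matches the components orthogonal to \<open>v\<close>.
  The isometry obtained from it must keep \<open>v\<close> fixed, and therefore the statement is strengthened:
  vectors orthogonal to both lists are fixed.
\<close>
lemma witt_extension:
  assumes "length vs = length ws" "orth_minor vs \<noteq> 0"
    and "\<And>i j. i < length vs \<Longrightarrow> j < length vs \<Longrightarrow> form (vs ! i) (vs ! j) = form (ws ! i) (ws ! j)"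
  shows "\<exists>g \<in> orthogonal_maps scale form. (\<forall>i<length vs. g (vs ! i) = ws ! i) \<and>
    (\<forall>z. (\<forall>x \<in> set vs \<union> set ws. form z x = 0) \<longrightarrow> g z = z)"
  using assms
proof (induction vs arbitrary: ws rule: orth_minor.induct)
  case 1
  then show ?case
    by (intro bexI[of _ "\<lambda>x. x"]) (auto simp: id_orthogonal)
next
  case (2 v vs)
  obtain w ws' where ws: "ws = w # ws'"
    using "2.prems"(1) by (cases ws) auto
  have len: "length vs = length ws'"
    using "2.prems"(1) ws by simp
  have vv: "form v v = form w w"
    using "2.prems"(3)[of 0 0] ws by simp
  have nz: "form v v \<noteq> 0" and minor: "orth_minor (map (deflate v) vs) \<noteq> 0"
    using "2.prems"(2) by auto
  have gram0: "form (vs ! i) v = form (ws' ! i) w" if "i < length vs" for i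
    using "2.prems"(3)[of "Suc i" 0] that ws by simp
  have gram: "form (vs ! i) (vs ! j) = form (ws' ! i) (ws' ! j)"
    if "i < length vs" "j < length vs" for i j
    using "2.prems"(3)[of "Suc i" "Suc j"] that ws by simp
  obtain h where h: "h \<in> orthogonal_maps scale form" "h w = v"
    and hz: "\<And>z. form z w = 0 \<Longrightarrow> form z v = 0 \<Longrightarrow> h z = z"
    using isometry_moving_vector[of w v] vv nz by auto
  have h_form: "form (h x) (h y) = form x y" for x y
    using h(1) by (simp add: orthogonal_maps_iff)
  have h_formv: "form (h x) v = form x w" for x
    using h_form[of x w] h(2) by simp
  have h_formv': "form v (h x) = form w x" for x
    using h_form[of w x] h(2) by simp
  \<comment> \<open>After \<open>h\<close> both lists have head \<open>v\<close>, so the deflated tails again have equal Gram matrices.\<close>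
  let ?vs = "map (deflate v) vs" and ?ws = "map (deflate v \<circ> h) ws'"
  have "\<exists>g \<in> orthogonal_maps scale form. (\<forall>i<length ?vs. g (?vs ! i) = ?ws ! i) \<and>
      (\<forall>z. (\<forall>x \<in> set ?vs \<union> set ?ws. form z x = 0) \<longrightarrow> g z = z)"
  proof (rule "2.IH")
    show "length ?vs = length ?ws" using len by simp
    show "orth_minor ?vs \<noteq> 0" by fact
    show "form (?vs ! i) (?vs ! j) = form (?ws ! i) (?ws ! j)"
      if "i < length ?vs" "j < length ?vs" for i j
      using that len gram0[of i] gram0[of j] gram[of i j]
      by (simp add: deflate_def form_simps form_sym h_formv h_formv' h_form)
  qed
  then obtain g where g: "g \<in> orthogonal_maps scale form"
    and gi: "\<And>i. i < length vs \<Longrightarrow> g (deflate v (vs ! i)) = deflate v (h (ws' ! i))"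
    and gz: "\<And>z. (\<forall>x \<in> set ?vs \<union> set ?ws. form z x = 0) \<Longrightarrow> g z = z"
    using len by auto
  have gv: "g v = v"
    by (rule gz) auto
  have gvs: "g (vs ! i) = h (ws' ! i)" if i: "i < length vs" for i
  proof -
    have "g (form v v *s (vs ! i)) = g (deflate v (vs ! i) + form (vs ! i) v *s v)"
      by (simp add: deflate_def)
    also have "\<dots> = deflate v (h (ws' ! i)) + form (ws' ! i) w *s v"
      using g gv gi[OF i] gram0[OF i] by (simp add: orthogonal_maps_iff)
    also have "\<dots> = form v v *s h (ws' ! i)"
      by (simp add: deflate_def h_formv)
    finally have "form v v *s g (vs ! i) = form v v *s h (ws' ! i)"
      using g by (simp add: orthogonal_maps_iff)
    then show ?thesis using nz by simp
  qed
  have inv_h: "inv_into UNIV h (h x) = x" for x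
    using h(1) by (simp add: orthogonal_maps_iff bij_is_inj)
  show ?case
  proof (intro bexI[of _ "inv_into UNIV h \<circ> g"] conjI allI impI)
    show "inv_into UNIV h \<circ> g \<in> orthogonal_maps scale form"
      using g h(1) by (simp add: orthogonal_maps_comp orthogonal_maps_inv)
    show "(inv_into UNIV h \<circ> g) ((v # vs) ! i) = ws ! i" if "i < length (v # vs)" for i
      using that inv_h[of w] inv_h h(2) gv gvs ws by (cases i) auto
    show "(inv_into UNIV h \<circ> g) z = z" if z: "\<forall>x \<in> set (v # vs) \<union> set ws. form z x = 0" for z
    proof -
      have hz': "h z = z" using z ws by (intro hz) auto
      have "form z (h x) = 0" if "x \<in> set ws'" for x
        using h_form[of z x] hz' z ws that by auto
      then have "g z = z"
        using z by (intro gz) (auto simp: deflate_def form_simps)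
      then show ?thesis using inv_h[of z] hz' by simp
    qed
  qed
qed

text \<open>
  Each head is non-isotropic and orthogonal to the deflated tail, hence outside its span.
\<close>
lemma dim_orth_minor:
  assumes "orth_minor vs \<noteq> 0"
  shows "length vs \<le> dim (set vs)"
  using assms
proof (induction vs rule: orth_minor.induct)
  case (2 v vs)
  let ?T = "deflate v ` set vs"
  have "form x v = 0" if "x \<in> span ?T" for x
    using that by (induction rule: span_induct_alt) (auto simp: form_simps)
  then have "v \<notin> span ?T" using 2 by auto
  then have "dim (insert v ?T) = dim ?T + 1"
    by (simp add: dim_insert)
  moreover have "insert v ?T \<subseteq> span (insert v (set vs))"
    by (auto simp: deflate_def intro!: span_diff span_scale intro: span_base)
  then have "dim (insert v ?T) \<le> dim (insert v (set vs))"
    by (rule dim_mono)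
  ultimately show ?case using 2 by auto
qed simp

lemma orthogonal_to_full_list:
  assumes "orth_minor vs \<noteq> 0" "length vs = dimension" "\<And>x. x \<in> set vs \<Longrightarrow> form z x = 0"
  shows "z = 0"
proof -
  have "dim (set vs) = dimension"
    using dim_orth_minor[OF assms(1)] assms(2) dim_subset_UNIV[of "set vs"] by simp
  then have "span (set vs) = UNIV"
    by (simp add: dim_eq_full)
  moreover have "form z x = 0" if "x \<in> span (set vs)" for x
    using that by (induction rule: span_induct_alt) (auto simp: form_simps assms(3))
  ultimately have "\<forall>x. form z x = 0" by auto
  then show ?thesis
    using nondegenerate by (simp add: nondegenerate_form_def)
qed

text \<open>
  If all vectors orthogonal to the \<open>e i\<close> were isotropic, then by polarization the form would vanish on
  the orthogonal complement, so the complement would lie in the radical and be zero; but the \<open>e i\<close>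
  are too few to span the space.
\<close>
lemma orthogonal_extension:
  assumes e: "\<And>i j. i < k \<Longrightarrow> j < k \<Longrightarrow> form (e i) (e j) = 0 \<longleftrightarrow> i \<noteq> j" and k: "k < dimension"
  shows "\<exists>z. form z z \<noteq> 0 \<and> (\<forall>i<k. form z (e i) = 0)"
proof (rule ccontr)
  assume "\<not> ?thesis"
  then have iso: "form z z = 0" if "\<And>i. i < k \<Longrightarrow> form z (e i) = 0" for z
    using that by auto
  \<comment> \<open>Projection to the orthogonal complement of the \<open>e i\<close>.\<close>
  define p where "p x = x - (\<Sum>i<k. (form x (e i) / form (e i) (e i)) *s e i)" for x
  have p_orth: "form (p x) (e j) = 0" if j: "j < k" for x j
  proof -
    have "(\<Sum>i<k. form x (e i) / form (e i) (e i) * form (e i) (e j)) =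
        (\<Sum>i<k. if i = j then form x (e j) else 0)"
      using e j by (intro sum.cong) auto
    then show ?thesis
      using j by (simp add: p_def form_simps form_sum_left)
  qed
  have p_p: "form (p x) (p y) = 0" for x y
  proof -
    have "form (p x + p y) (p x + p y) = 0"
      by (intro iso) (simp add: form_add_left p_orth)
    moreover have "form (p x) (p x) = 0" "form (p y) (p y) = 0"
      by (intro iso p_orth; assumption)+
    ultimately have "2 * form (p x) (p y) = 0"
      by (simp add: form_simps form_sym)
    then show ?thesis using two_nonzero by simp
  qed
  have "form (p x) y = 0" for x y
  proof -
    have y: "y = p y + (\<Sum>i<k. (form y (e i) / form (e i) (e i)) *s e i)"
      by (simp add: p_def)
    show ?thesis
      by (subst y) (simp add: form_simps form_sum_right p_p p_orth)
  qed
  then have p0: "p x = 0" for x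
    using nondegenerate by (simp add: nondegenerate_form_def)
  have "x - p x \<in> span (e ` {..<k})" for x
    unfolding p_def by (auto intro!: span_sum span_scale intro: span_base)
  then have "x \<in> span (e ` {..<k})" for x
    by (simp only: p0 diff_0_right)
  then have "dim (UNIV :: 'v set) \<le> card (e ` {..<k})"
    by (intro dim_le_card) auto
  also have "\<dots> \<le> k"
    using card_image_le[of "{..<k}" e] by simp
  finally show False
    using k by (simp add: dimension_def)
qed

lemma orthogonal_basis_exists:
  "\<exists>e. \<forall>i<dimension. \<forall>j<dimension. form (e i) (e j) = 0 \<longleftrightarrow> i \<noteq> j"
proof -
  have "\<exists>e. \<forall>i<k. \<forall>j<k. form (e i) (e j) = 0 \<longleftrightarrow> i \<noteq> j" if "k \<le> dimension" for k
    using that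
  proof (induction k)
    case (Suc k)
    then obtain e where e: "\<forall>i<k. \<forall>j<k. form (e i) (e j) = 0 \<longleftrightarrow> i \<noteq> j" by auto
    then obtain z where z: "form z z \<noteq> 0" "\<forall>i<k. form z (e i) = 0"
      using orthogonal_extension[of k e] Suc.prems by auto
    show ?case
      using e z by (intro exI[of _ "e(k := z)"]) (auto simp: less_Suc_eq form_sym)
  qed auto
  then show ?thesis by blast
qed

lemma orth_minor_orthogonal:
  assumes "\<And>i j. i < length vs \<Longrightarrow> j < length vs \<Longrightarrow> form (vs ! i) (vs ! j) = 0 \<longleftrightarrow> i \<noteq> j"
  shows "orth_minor vs \<noteq> 0"
  using assms
proof (induction vs rule: orth_minor.induct)
  case (2 v vs)
  have v: "form v v \<noteq> 0"
    using "2.prems"[of 0 0] by simp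
  have d: "deflate v (vs ! i) = form v v *s (vs ! i)" if "i < length vs" for i
    using "2.prems"[of "Suc i" 0] that by (simp add: deflate_def)
  have "orth_minor (map (deflate v) vs) \<noteq> 0"
  proof (rule "2.IH")
    show "form (map (deflate v) vs ! i) (map (deflate v) vs ! j) = 0 \<longleftrightarrow> i \<noteq> j"
      if "i < length (map (deflate v) vs)" "j < length (map (deflate v) vs)" for i j
      using that "2.prems"[of "Suc i" "Suc j"] v by (simp add: d form_simps)
  qed
  with v show ?case by simp
qed simp

lemma polyfun_orth_minor:
  assumes "\<And>X. X \<in> set Xs \<Longrightarrow> polyvec n X"
  shows "polyfun n (\<lambda>P. orth_minor (map (\<lambda>X. X P) Xs))"
  using assms
proof (induction "length Xs" arbitrary: Xs)
  case 0
  then show ?case by (simp add: polyfun.const)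
next
  case (Suc l)
  then obtain Y Ys where Xs: "Xs = Y # Ys" by (cases Xs) auto
  have Y: "polyvec n Y" using Suc.prems Xs by auto
  define Zs where "Zs = map (\<lambda>X P. deflate (Y P) (X P)) Ys"
  have "polyfun n (\<lambda>P. orth_minor (map (\<lambda>X. X P) Zs))"
  proof (rule Suc.hyps(1))
    show "l = length Zs" using Suc.hyps(2) by (simp add: Zs_def Xs)
    show "polyvec n X" if "X \<in> set Zs" for X
      using that Suc.prems Y
      by (auto simp: Zs_def Xs deflate_def intro!: polyvec_diff polyvec_scale polyfun_form)
  qed
  then show ?case
    using polyfun.mult[OF polyfun_form[OF Y Y]] by (simp add: Xs Zs_def comp_def)
qed

lemma affine_orthogonal_comp:
  assumes "f \<in> affine_orthogonal_group scale form" "g \<in> affine_orthogonal_group scale form"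
  shows "f \<circ> g \<in> affine_orthogonal_group scale form"
proof -
  let ?H = "orthogonal_maps scale form \<union> {\<lambda>x. x + t |t. True}"
  have "bij (\<lambda>x. x + t)" for t :: 'v
    by (rule o_bij[of "\<lambda>x. x - t"]) auto
  then have H: "?H \<subseteq> carrier (BijGroup UNIV)"
    by (auto simp: orthogonal_maps_iff BijGroup_def Bij_def)
  have "f \<in> carrier (BijGroup UNIV)" "g \<in> carrier (BijGroup UNIV)"
    using assms group.generate_in_carrier[OF group_BijGroup H]
    unfolding affine_orthogonal_group_def by blast+
  then have "f \<otimes>\<^bsub>BijGroup UNIV\<^esub> g = f \<circ> g"
    by (simp add: BijGroup_def compose_def comp_def restrict_def)
  then show ?thesis
    using assms generate.eng[of f "BijGroup UNIV" ?H g]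
    by (simp add: affine_orthogonal_group_def)
qed

lemma affine_orthogonal_translation: "(\<lambda>x. x + t) \<in> affine_orthogonal_group scale form"
  unfolding affine_orthogonal_group_def by (rule generate.incl) auto

lemma affine_orthogonal_linear:
  "g \<in> orthogonal_maps scale form \<Longrightarrow> g \<in> affine_orthogonal_group scale form"
  unfolding affine_orthogonal_group_def by (rule generate.incl) auto

text \<open>Distances determine inner products of difference vectors, since \<open>2\<close> is invertible.\<close>
lemma polarized_distance:
  "2 * form (P i - P k) (P j - P k) =
    sq_distance form P i k + sq_distance form P j k - sq_distance form P i j"
  by (simp add: sq_distance_def form_simps form_sym)

definition frame_minor :: "nat \<Rightarrow> (nat \<Rightarrow> 'v) \<Rightarrow> 'a"
  where "frame_minor r P = orth_minor (map (\<lambda>i. P (i + 2) - P 1) [0..<r])"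

text \<open>
  If the first \<open>r = min m (n - 1)\<close> difference vectors exhaust all points, Witt's theorem is enough.
  Otherwise \<open>r = m\<close>, these vectors span the space, and every other point is determined by its
  inner products with them.
\<close>
lemma congruent_if_distances_equal:
  assumes minor: "frame_minor (min dimension (n - 1)) P \<noteq> 0"
    and dist: "\<And>i j. i \<in> {1..n} \<Longrightarrow> j \<in> {1..n} \<Longrightarrow> sq_distance form P i j = sq_distance form Q i j"
  shows "\<exists>g \<in> affine_orthogonal_group scale form. \<forall>i\<in>{1..n}. g (P i) = Q i"
proof -
  define r where "r = min dimension (n - 1)"
  let ?vs = "\<lambda>P. map (\<lambda>i. P (i + 2) - P 1) [0..<r]"
  have gram: "form (P i - P 1) (P j - P 1) = form (Q i - Q 1) (Q j - Q 1)"
    if "i \<in> {1..n}" "j \<in> {1..n}" for i j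
  proof -
    have "1 \<in> {1..n}" using that by auto
    then have "2 * form (P i - P 1) (P j - P 1) = 2 * form (Q i - Q 1) (Q j - Q 1)"
      unfolding polarized_distance using that by (simp only: dist)
    then show ?thesis using two_nonzero by simp
  qed
  have "\<exists>g \<in> orthogonal_maps scale form. (\<forall>i<length (?vs P). g (?vs P ! i) = ?vs Q ! i) \<and>
    (\<forall>z. (\<forall>x \<in> set (?vs P) \<union> set (?vs Q). form z x = 0) \<longrightarrow> g z = z)"
  proof (rule witt_extension)
    show "orth_minor (?vs P) \<noteq> 0" using minor by (simp add: frame_minor_def r_def)
    show "form (?vs P ! i) (?vs P ! j) = form (?vs Q ! i) (?vs Q ! j)"
      if "i < length (?vs P)" "j < length (?vs P)" for i j
    proof -
      have "i + 2 \<in> {1..n}" "j + 2 \<in> {1..n}"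
        using that by (auto simp: r_def)
      then show ?thesis using gram[of "i + 2" "j + 2"] that by simp
    qed
  qed simp
  then obtain g where g: "g \<in> orthogonal_maps scale form"
    and gi: "\<And>i. i < r \<Longrightarrow> g (P (i + 2) - P 1) = Q (i + 2) - Q 1"
    by auto
  have g0: "g 0 = 0"
    using g unfolding orthogonal_maps_iff by (metis add_cancel_right_right)
  have all: "g (P i - P 1) = Q i - Q 1" if i: "i \<in> {1..n}" for i
  proof -
    consider "i = 1" | "2 \<le> i" "i - 2 < r" | "2 \<le> i" "r \<le> i - 2" using i by force
    then show ?thesis
    proof cases
      case 1
      then show ?thesis by (simp add: g0)
    next
      case 2
      then show ?thesis using gi[of "i - 2"] by (simp only: le_add_diff_inverse2)
    next
      case 3
      then have r: "r = dimension" using i by (auto simp: r_def)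
      obtain g' where g': "g' = inv_into UNIV g" "g' \<in> orthogonal_maps scale form"
        using g orthogonal_maps_inv by blast
      have gg': "g' (g x) = x" "g (g' x) = x" for x
        using g by (auto simp: g'(1) orthogonal_maps_iff bij_is_inj bij_is_surj surj_f_inv_f)
      \<comment> \<open>Both vectors have the same inner products with a spanning list.\<close>
      have "(P i - P 1) - g' (Q i - Q 1) = 0"
      proof (rule orthogonal_to_full_list)
        show "orth_minor (?vs P) \<noteq> 0" using minor by (simp add: frame_minor_def r_def)
        show "length (?vs P) = dimension" by (simp add: r)
        fix x assume "x \<in> set (?vs P)"
        then obtain j where j: "j < r" and x: "x = P (j + 2) - P 1" by auto
        have jn: "j + 2 \<in> {1..n}" using j by (auto simp: r_def)
        have "form (g' (Q i - Q 1)) x = form (Q i - Q 1) (g x)"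
          using g gg' by (metis orthogonal_maps_iff)
        then have "form (P i - P 1 - g' (Q i - Q 1)) x = form (P i - P 1) x - form (Q i - Q 1) (g x)"
          by (simp only: form_diff_left[of "P i - P 1"])
        also have "\<dots> = 0"
          unfolding x gi[OF j] using gram[OF i jn] by simp
        finally show "form (P i - P 1 - g' (Q i - Q 1)) x = 0" .
      qed
      then show ?thesis by (metis gg'(2) eq_iff_diff_eq_0)
    qed
  qed
  let ?g = "(\<lambda>x. x + Q 1) \<circ> (g \<circ> (\<lambda>x. x + (- P 1)))"
  have "?g \<in> affine_orthogonal_group scale form"
    by (intro affine_orthogonal_comp affine_orthogonal_translation affine_orthogonal_linear g)
  moreover have "?g (P i) = Q i" if "i \<in> {1..n}" for i
    using all[OF that] by simp
  ultimately show ?thesis by blast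
qed

end

section \<open>Edge permutations and vertex permutations\<close>

definition edges :: "nat \<Rightarrow> nat set set"
  where "edges n = {e. e \<subseteq> {1..n} \<and> card e = 2}"

lemma finite_edges: "finite (edges n)"
  unfolding edges_def by (rule finite_subset[of _ "Pow {1..n}"]) auto

lemma doubleton_in_edges: "{i, j} \<in> edges n \<longleftrightarrow> i \<in> {1..n} \<and> j \<in> {1..n} \<and> i \<noteq> j"
  by (cases "i = j") (auto simp: edges_def)

text \<open>
  The three sides are not listed up to order: any assignment of the sides of a triangle to
  \<open>{i, j}\<close>, \<open>{j, k}\<close>, \<open>{i, k}\<close> has the form below, with \<open>b\<close> the common vertex of the first two.
\<close>
definition triangle_preserving :: "nat \<Rightarrow> (nat set \<Rightarrow> nat set) \<Rightarrow> bool"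
  where "triangle_preserving n \<phi> \<longleftrightarrow>
    (\<forall>i\<in>{1..n}. \<forall>j\<in>{1..n}. \<forall>k\<in>{1..n}. i \<noteq> j \<longrightarrow> j \<noteq> k \<longrightarrow> i \<noteq> k \<longrightarrow>
      (\<exists>a b c. a \<noteq> b \<and> b \<noteq> c \<and> a \<noteq> c \<and>
        \<phi> {i, j} = {a, b} \<and> \<phi> {j, k} = {b, c} \<and> \<phi> {i, k} = {a, c}))"

text \<open>
  No edge other than \<open>e1\<close> contains both its ends, so one end lies on \<open>e2\<close> but not on
  \<open>e3\<close>, and the other on \<open>e3\<close> but not on \<open>e2\<close>; the second end of \<open>e2\<close> must then lie on \<open>e3\<close>.
\<close>
lemma three_edges_triangle:
  assumes card: "card e1 = 2" "card e2 = 2" "card e3 = 2"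
    and distinct: "e1 \<noteq> e2" "e1 \<noteq> e3" "e2 \<noteq> e3"
    and cover: "\<And>v. v \<in> e1 \<Longrightarrow> v \<in> e2 \<or> v \<in> e3" "\<And>v. v \<in> e2 \<Longrightarrow> v \<in> e1 \<or> v \<in> e3"
  shows "\<exists>a b c. a \<noteq> b \<and> b \<noteq> c \<and> a \<noteq> c \<and> e1 = {a, b} \<and> e2 = {b, c} \<and> e3 = {a, c}"
proof -
  have two: "e = {x, y}" if "card e = 2" "x \<in> e" "y \<in> e" "x \<noteq> y" for e and x y :: 'a
    using that by (auto simp: card_2_iff)
  obtain x y where xy: "e1 = {x, y}" "x \<noteq> y"
    using card(1) by (auto simp: card_2_iff)
  obtain a b where ab: "e1 = {a, b}" "a \<noteq> b" "b \<in> e2" "a \<in> e3" "a \<notin> e2"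
    using xy cover(1)[of x] cover(1)[of y] two[OF card(2), of x y] two[OF card(3), of x y]
      distinct by (cases "x \<in> e2") (metis insert_commute insertCI)+
  obtain c where c: "e2 = {b, c}" "b \<noteq> c"
    using card(2) ab(3) by (auto simp: card_2_iff insert_commute)
  then have "c \<noteq> a" "c \<in> e3"
    using ab cover(2)[of c] by auto
  then show ?thesis
    using ab c two[OF card(3), of a c] by blast
qed

text \<open>
  Edges at a vertex \<open>v\<close> pairwise lie in a common triangle, so their images pairwise meet. They
  even share one vertex: if \<open>\<phi> {v, a} = {p, q}\<close> and \<open>\<phi> {v, b} = {q, r}\<close>, an edge that meets both
  and avoids \<open>q\<close> is \<open>{p, r} = \<phi> {a, b}\<close>. The common vertex is the image of \<open>v\<close>. Two vertices
  cannot have the same image, since the three sides of a triangle have no common point.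
\<close>
lemma triangle_preserving_induced:
  assumes perm: "\<phi> permutes edges n" and tri: "triangle_preserving n \<phi>"
  shows "\<exists>\<pi>. \<pi> permutes {1..n} \<and> (\<forall>i\<in>{1..n}. \<forall>j\<in>{1..n}. i \<noteq> j \<longrightarrow> \<phi> {i, j} = {\<pi> i, \<pi> j})"
proof (cases "n \<le> 2")
  case True
  have "e = {1, 2}" if "e \<in> edges n" for e
    using that True card_seteq[of "{1, 2}" e] by (fastforce simp: edges_def)
  then have "\<phi> e = e" if "e \<in> edges n" for e
    using that permutes_in_image[OF perm, of e] by metis
  then show ?thesis
    by (intro exI[of _ id]) (auto simp: permutes_id doubleton_in_edges)
next
  case False
  have inj: "\<phi> e = \<phi> e' \<Longrightarrow> e = e'" for e e'
    using permutes_inj[OF perm] by (simp add: inj_eq)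
  have triangle: "\<exists>a b c. a \<noteq> b \<and> b \<noteq> c \<and> a \<noteq> c \<and>
      \<phi> {i, j} = {a, b} \<and> \<phi> {j, k} = {b, c} \<and> \<phi> {i, k} = {a, c}"
    if "i \<in> {1..n}" "j \<in> {1..n}" "k \<in> {1..n}" "i \<noteq> j" "j \<noteq> k" "i \<noteq> k" for i j k
    using tri that unfolding triangle_preserving_def by blast
  have third: "\<exists>c\<in>{1..n}. c \<noteq> a \<and> c \<noteq> b" for a b
  proof (rule ccontr)
    assume "\<not> ?thesis"
    then have "{1..n} \<subseteq> {a, b}" by auto
    then have "card {1..n} \<le> card {a, b}" by (rule card_mono[rotated]) simp
    then show False using False card_insert_le_m1[of 2 "{b}" a] by (auto simp: card_insert_if split: if_splits)
  qed
  have star: "\<exists>w. \<forall>c\<in>{1..n}. c \<noteq> v \<longrightarrow> w \<in> \<phi> {v, c}" if v: "v \<in> {1..n}" for v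
  proof -
    obtain a where a: "a \<in> {1..n}" "a \<noteq> v" using third[of v v] by auto
    obtain b where b: "b \<in> {1..n}" "b \<noteq> v" "b \<noteq> a" using third[of v a] by auto
    obtain p q r where pqr: "p \<noteq> q" "q \<noteq> r" "p \<noteq> r"
      "\<phi> {a, v} = {p, q}" "\<phi> {v, b} = {q, r}" "\<phi> {a, b} = {p, r}"
      using triangle[of a v b] a b v by auto
    have "q \<in> \<phi> {v, c}" if c: "c \<in> {1..n}" "c \<noteq> v" for c
    proof (cases "c = a \<or> c = b")
      case True
      then show ?thesis using pqr by (auto simp: insert_commute)
    next
      case False
      have meet: "\<phi> {x, v} \<inter> \<phi> {v, c} \<noteq> {}" if "x \<in> {1..n}" "x \<noteq> v" "x \<noteq> c" for x
        using triangle[of x v c] that c v by fastforce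
      have "{p, q} \<inter> \<phi> {v, c} \<noteq> {}" "{q, r} \<inter> \<phi> {v, c} \<noteq> {}"
        using meet[of a] meet[of b] a b False pqr by (auto simp: insert_commute)
      moreover have "card (\<phi> {v, c}) = 2"
        using permutes_in_image[OF perm, of "{v, c}"] c v by (simp add: doubleton_in_edges) (simp add: edges_def)
      moreover have "\<phi> {v, c} \<noteq> {p, r}"
        using inj[of "{v, c}" "{a, b}"] pqr a b by (auto simp: doubleton_eq_iff)
      ultimately show ?thesis
        using pqr by (auto simp: card_2_iff)
    qed
    then show ?thesis by blast
  qed
  define \<pi> where "\<pi> v = (if v \<in> {1..n} then SOME w. \<forall>c\<in>{1..n}. c \<noteq> v \<longrightarrow> w \<in> \<phi> {v, c} else v)" for v
  have \<pi>: "\<pi> v \<in> \<phi> {v, c}" if "v \<in> {1..n}" "c \<in> {1..n}" "c \<noteq> v" for v c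
    using someI_ex[OF star[OF that(1)]] that by (simp add: \<pi>_def)
  have in_range: "\<pi> v \<in> {1..n}" if v: "v \<in> {1..n}" for v
  proof -
    obtain c where c: "c \<in> {1..n}" "c \<noteq> v" using third[of v v] by auto
    then have "\<phi> {v, c} \<in> edges n"
      using permutes_in_image[OF perm, of "{v, c}"] v by (auto simp: doubleton_in_edges)
    then show ?thesis using \<pi>[OF v c] by (auto simp: edges_def)
  qed
  have inj_\<pi>: "\<pi> v \<noteq> \<pi> v'" if v: "v \<in> {1..n}" "v' \<in> {1..n}" "v \<noteq> v'" for v v'
  proof
    assume eq: "\<pi> v = \<pi> v'"
    obtain c where c: "c \<in> {1..n}" "c \<noteq> v" "c \<noteq> v'" using third[of v v'] by auto
    obtain p q r where pqr: "p \<noteq> q" "q \<noteq> r" "p \<noteq> r"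
      "\<phi> {v, v'} = {p, q}" "\<phi> {v', c} = {q, r}" "\<phi> {v, c} = {p, r}"
      using triangle[of v v' c] c v by auto
    have "\<pi> v \<in> {p, q}" "\<pi> v \<in> {q, r}" "\<pi> v \<in> {p, r}"
      using \<pi>[of v v'] \<pi>[of v' c] \<pi>[of v c] eq pqr c v by auto
    then show False using pqr by auto
  qed
  have "\<pi> permutes {1..n}"
  proof (rule bij_imp_permutes)
    have "inj_on \<pi> {1..n}" using inj_\<pi> by (meson inj_onI)
    moreover have "\<pi> ` {1..n} \<subseteq> {1..n}" using in_range by blast
    ultimately show "bij_betw \<pi> {1..n} {1..n}"
      by (simp add: bij_betw_def endo_inj_surj)
  qed (auto simp: \<pi>_def)
  moreover have "\<phi> {i, j} = {\<pi> i, \<pi> j}" if ij: "i \<in> {1..n}" "j \<in> {1..n}" "i \<noteq> j" for i j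
  proof -
    have "card (\<phi> {i, j}) = 2"
      using permutes_in_image[OF perm, of "{i, j}"] ij by (simp add: doubleton_in_edges) (simp add: edges_def)
    moreover have "\<pi> i \<in> \<phi> {i, j}" "\<pi> j \<in> \<phi> {i, j}" "\<pi> i \<noteq> \<pi> j"
      using \<pi>[of i j] \<pi>[of j i] inj_\<pi> ij by (auto simp: insert_commute)
    ultimately show ?thesis by (auto simp: card_2_iff)
  qed
  ultimately show ?thesis by blast
qed

lemma sum_singleton_mset: "finite A \<Longrightarrow> (\<Sum>x\<in>A. {#f x#}) = image_mset f (mset_set A)"
  by (induction A rule: finite_induct) auto

text \<open>Both products have the same multiset of roots.\<close>
lemma permutation_if_linear_products_eq:
  fixes d d' :: "'b \<Rightarrow> 'a::field"
  assumes "finite E" "(\<Prod>e\<in>E. [:- d e, 1:]) = (\<Prod>e\<in>E. [:- d' e, 1:])"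
  obtains \<phi> where "\<phi> permutes E" "\<And>e. e \<in> E \<Longrightarrow> d e = d' (\<phi> e)"
proof -
  have lin: "proots [:- a, 1:] = {#a#}" for a :: 'a
    using proots_linear_factor by simp
  have "proots (\<Prod>e\<in>E. [:- d e, 1:]) = image_mset d (mset_set E)" for d :: "'b \<Rightarrow> 'a"
    using assms(1) by (subst proots_prod) (auto simp: lin sum_singleton_mset)
  then have "image_mset d (mset_set E) = image_mset d' (mset_set E)"
    using assms(2) by metis
  then show ?thesis
    using image_mset_eq_implies_permutes[OF assms(1)] that by metis
qed

context quadratic_space
begin

text \<open>
  Distances as a function on edges; on a singleton \<open>{i}\<close> the value is \<open>0\<close>, so that double sums need
  not exclude the diagonal.
\<close>
definition edge_distance :: "(nat \<Rightarrow> 'v) \<Rightarrow> nat set \<Rightarrow> 'a"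
  where "edge_distance P e = sq_distance form P (Min e) (Max e)"

lemma sq_distance_commute: "sq_distance form P i j = sq_distance form P j i"
  by (simp add: sq_distance_def form_diff_left form_diff_right)

lemma edge_distance_doubleton: "edge_distance P {i, j} = sq_distance form P i j"
  using sq_distance_commute[of P i j] by (auto simp: edge_distance_def min_def max_def)

lemma distance_poly_edges: "distance_poly form n P = (\<Prod>e\<in>edges n. [:- edge_distance P e, 1:])"
proof -
  let ?S = "{(i, j). 1 \<le> i \<and> i < j \<and> j \<le> n}"
  have "bij_betw (\<lambda>(i, j). {i, j}) ?S (edges n)"
  proof (rule bij_betwI')
    show "((\<lambda>(i, j). {i, j}) p = (\<lambda>(i, j). {i, j}) q) = (p = q)" if "p \<in> ?S" "q \<in> ?S" for p q
      using that by (auto simp: doubleton_eq_iff)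
    show "(\<lambda>(i, j). {i, j}) p \<in> edges n" if "p \<in> ?S" for p
      using that by (auto simp: doubleton_in_edges)
    show "\<exists>p\<in>?S. e = (\<lambda>(i, j). {i, j}) p" if edge: "e \<in> edges n" for e
    proof -
      obtain i j where e: "e = {i, j}" "i \<noteq> j"
        using edge by (auto simp: edges_def card_2_iff)
      consider "(i, j) \<in> ?S" | "(j, i) \<in> ?S"
        using edge e by (auto simp: doubleton_in_edges) linarith
      then show ?thesis
        by cases (rule bexI[rotated], assumption, simp add: e insert_commute)+
    qed
  qed
  from prod.reindex_bij_betw[OF this, of "\<lambda>e. [:- edge_distance P e, 1:]", symmetric]
  show ?thesis
    by (simp add: distance_poly_def case_prod_unfold edge_distance_doubleton)
qed

end

section \<open>The rank of rearranged distances\<close>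

text \<open>
  The bilinear form of an edge function \<open>D\<close>. On vectors with coordinate sum zero and for
  the distances of a configuration it is \<open>-2\<close> times a Gram matrix
  (\<open>edge_form_of_configuration\<close>).
\<close>
definition edge_form :: "nat \<Rightarrow> (nat set \<Rightarrow> 'a::field) \<Rightarrow> (nat \<Rightarrow> 'a) \<Rightarrow> (nat \<Rightarrow> 'a) \<Rightarrow> 'a"
  where "edge_form n D h h' = (\<Sum>i\<in>{1..n}. \<Sum>j\<in>{1..n}. D {i, j} * h i * h' j)"

lemma edge_form_commute: "edge_form n D h h' = edge_form n D h' h"
  unfolding edge_form_def
  by (subst sum.swap) (simp add: insert_commute mult.assoc mult.commute[of "h _"])

lemma edge_form_diff_right:
  "edge_form n D h (\<lambda>i. f i - g i) = edge_form n D h f - edge_form n D h g"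
  by (simp add: edge_form_def algebra_simps sum_subtractf)

lemma edge_form_diff_left:
  "edge_form n D (\<lambda>i. f i - g i) h = edge_form n D f h - edge_form n D g h"
  by (simp add: edge_form_def algebra_simps sum_subtractf)

lemma edge_form_lincomb:
  "edge_form n (\<lambda>e. D e + c * D' e) h h' = edge_form n D h h' + c * edge_form n D' h h'"
  by (simp add: edge_form_def algebra_simps sum.distrib sum_distrib_left)

lemma edge_form_cong:
  assumes "\<And>i j. i \<in> {1..n} \<Longrightarrow> j \<in> {1..n} \<Longrightarrow> D {i, j} = D' {i, j}"
  shows "edge_form n D h h' = edge_form n D' h h'"
  unfolding edge_form_def by (intro sum.cong refl) (simp add: assms)

lemma edge_form_delta:
  assumes "p \<in> {1..n}" "q \<in> {1..n}"
  shows "edge_form n D (\<lambda>i. of_bool (i = p)) (\<lambda>i. of_bool (i = q)) = D {p, q}"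
proof -
  have "(\<Sum>j\<in>{1..n}. D {i, j} * of_bool (i = p) * of_bool (j = q)) =
      (if i = p then D {p, q} else 0)" for i
    using assms(2) sum.delta[of "{1..n}" q "\<lambda>j. D {i, j} * of_bool (i = p)"]
    by (simp add: of_bool_def if_distrib cong: if_cong)
  then show ?thesis
    using assms(1) by (simp add: edge_form_def)
qed

lemma edge_form_single_edge:
  assumes "p \<in> {1..n}" "q \<in> {1..n}" "p \<noteq> q"
  shows "edge_form n (\<lambda>e. if e = {p, q} then c else 0) h h = 2 * c * h p * h q"
proof -
  have "(if {i, j} = {p, q} then c else 0) * h i * h j =
      (if i = p then if j = q then c * h p * h q else 0 else 0) +
      (if i = q then if j = p then c * h p * h q else 0 else 0)" for i j
    using assms(3) by (auto simp: doubleton_eq_iff)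
  then have "edge_form n (\<lambda>e. if e = {p, q} then c else 0) h h =
      (\<Sum>i\<in>{1..n}. \<Sum>j\<in>{1..n}. (if i = p then if j = q then c * h p * h q else 0 else 0)) +
      (\<Sum>i\<in>{1..n}. \<Sum>j\<in>{1..n}. (if i = q then if j = p then c * h p * h q else 0 else 0))"
    unfolding edge_form_def by (simp only: sum.distrib)
  also have "(\<Sum>i\<in>{1..n}. \<Sum>j\<in>{1..n}. (if i = p then if j = q then c * h p * h q else 0 else 0)) =
      (\<Sum>i\<in>{1..n}. if i = p then c * h p * h q else 0)"
    using assms by (intro sum.cong) (auto simp: sum.delta)
  also have "(\<Sum>i\<in>{1..n}. \<Sum>j\<in>{1..n}. (if i = q then if j = p then c * h p * h q else 0 else 0)) =
      (\<Sum>i\<in>{1..n}. if i = q then c * h p * h q else 0)"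
    using assms by (intro sum.cong) (auto simp: sum.delta)
  finally show ?thesis
    using assms by simp
qed

text \<open>The distance function of points \<open>x i\<close> on a line.\<close>
definition square_gap :: "(nat \<Rightarrow> 'a::field) \<Rightarrow> nat set \<Rightarrow> 'a"
  where "square_gap x e = (x (Min e) - x (Max e))\<^sup>2"

lemma square_gap_doubleton: "square_gap x {i, j} = (x i - x j)\<^sup>2"
  by (auto simp: square_gap_def min_def max_def power2_commute)

lemma permuted_edge_doubleton:
  assumes "\<phi> permutes edges n" "i \<in> {1..n}" "j \<in> {1..n}"
  shows "\<exists>c d. \<phi> {i, j} = {c, d}"
proof (cases "i = j")
  case True
  then have "\<phi> {i, j} = {i, j}"
    using permutes_not_in[OF assms(1)] by (simp add: edges_def)
  then show ?thesis by blast
next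
  case False
  then have "\<phi> {i, j} \<in> edges n"
    using assms permutes_in_image[OF assms(1), of "{i, j}"] by (simp add: doubleton_in_edges)
  then show ?thesis by (auto simp: edges_def card_2_iff)
qed

text \<open>
  Polarization at the indicators of \<open>a\<close> and \<open>b\<close> shows that the indicator of the edge \<open>{a, b}\<close>
  is a linear combination of functions \<open>square_gap x\<close>. A vector \<open>h \<noteq> 0\<close> with coordinate sum zero has two non-zero entries
  \<open>h p\<close> and \<open>h q\<close>, and
  the indicator of \<open>\<phi> {p, q}\<close>, rearranged by \<open>\<phi>\<close>, takes the value \<open>2 h p h q\<close> on \<open>h\<close>.
\<close>
lemma square_gap_detects:
  fixes h :: "nat \<Rightarrow> 'a::field"
  assumes two: "(2::'a) \<noteq> 0" and perm: "\<phi> permutes edges n"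
    and h0: "(\<Sum>i\<in>{1..n}. h i) = 0" and h: "\<exists>i\<in>{1..n}. h i \<noteq> 0"
  shows "\<exists>x. edge_form n (square_gap x \<circ> \<phi>) h h \<noteq> 0"
proof (rule ccontr)
  assume "\<not> ?thesis"
  then have zero: "edge_form n (square_gap x \<circ> \<phi>) h h = 0" for x by blast
  obtain p where p: "p \<in> {1..n}" "h p \<noteq> 0" using h by blast
  have "\<exists>q\<in>{1..n}. q \<noteq> p \<and> h q \<noteq> 0"
  proof (rule ccontr)
    assume "\<not> ?thesis"
    then have "(\<Sum>i\<in>{1..n}. h i) = (\<Sum>i\<in>{1..n}. if i = p then h p else 0)"
      by (intro sum.cong) auto
    then show False using p h0 by simp
  qed
  then obtain q where q: "q \<in> {1..n}" "q \<noteq> p" "h q \<noteq> 0" by blast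
  have "\<phi> {p, q} \<in> edges n"
    using permutes_in_image[OF perm, of "{p, q}"] p q by (simp add: doubleton_in_edges)
  then obtain a b where ab: "\<phi> {p, q} = {a, b}" "a \<noteq> b"
    by (auto simp: edges_def card_2_iff)
  let ?d = "\<lambda>a i. of_bool (i = a) :: 'a"
  let ?g = "\<lambda>x e. square_gap x (\<phi> e)"
  have polar: "square_gap (\<lambda>i. ?d a i + ?d b i) {c, d} + (-1) * square_gap (?d a) {c, d}
      + (-1) * square_gap (?d b) {c, d} = (if {c, d} = {a, b} then - 2 else 0)" for c d
    using ab(2) by (auto simp: square_gap_doubleton doubleton_eq_iff power2_eq_square)
  have "edge_form n (\<lambda>e. if e = {p, q} then - 2 else 0) h h =
      edge_form n (\<lambda>e. ?g (\<lambda>i. ?d a i + ?d b i) e + (-1) * ?g (?d a) e + (-1) * ?g (?d b) e) h h"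
  proof (rule edge_form_cong)
    fix i j assume ij: "i \<in> {1..n}" "j \<in> {1..n}"
    obtain c d where cd: "\<phi> {i, j} = {c, d}"
      using permuted_edge_doubleton[OF perm ij] by blast
    have "{c, d} = {a, b} \<longleftrightarrow> {i, j} = {p, q}"
      using permutes_inj[OF perm] ab(1) cd by (metis injD)
    then show "(if {i, j} = {p, q} then - 2 else 0) = ?g (\<lambda>i. ?d a i + ?d b i) {i, j}
        + (-1) * ?g (?d a) {i, j} + (-1) * ?g (?d b) {i, j}"
      unfolding cd polar by simp
  qed
  also have "\<dots> = 0"
    unfolding edge_form_lincomb using zero by (simp add: comp_def)
  finally have "2 * (- 2) * h p * h q = 0"
    using edge_form_single_edge[of p n q "- 2" h] p q by metis
  then show False using two p q by (metis mult_eq_0_iff neg_equal_0_iff_equal)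
qed

lemma det_antidiagonal_nonzero:
  fixes M :: "nat \<Rightarrow> nat \<Rightarrow> 'a::field"
  assumes "M 0 0 = 0" "M 1 1 = 0" "M 0 1 \<noteq> 0" "M 1 0 \<noteq> 0"
  shows "det (mat 2 2 (\<lambda>(i, j). M i j)) \<noteq> 0"
proof
  let ?M = "mat 2 2 (\<lambda>(i, j). M i j)"
  assume "det ?M = 0"
  then obtain v where v: "v \<in> carrier_vec 2" "v \<noteq> 0\<^sub>v 2" "?M *\<^sub>v v = 0\<^sub>v 2"
    using det_0_iff_vec_prod_zero_field[of ?M 2] by auto
  have "(?M *\<^sub>v v) $ 0 = 0" "(?M *\<^sub>v v) $ 1 = 0" by (simp_all add: v(3))
  then have "v $ 0 = 0" "v $ 1 = 0"
    using assms v(1) by (simp_all add: scalar_prod_def numeral_2_eq_2)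
  then have "v = 0\<^sub>v 2"
    using v(1) by (intro eq_vecI) (auto simp: less_2_cases_iff)
  then show False using v(2) by simp
qed

lemma not_triangle_preserving_witness:
  assumes perm: "\<phi> permutes edges n" and nt: "\<not> triangle_preserving n \<phi>"
  obtains i j k v where "i \<in> {1..n}" "j \<in> {1..n}" "k \<in> {1..n}" "i \<noteq> j" "j \<noteq> k" "i \<noteq> k"
    "v \<in> \<phi> {i, j}" "v \<notin> \<phi> {j, k}" "v \<notin> \<phi> {i, k}"
proof -
  obtain i j k where ijk: "i \<in> {1..n}" "j \<in> {1..n}" "k \<in> {1..n}" "i \<noteq> j" "j \<noteq> k" "i \<noteq> k"
    and no: "\<nexists>a b c. a \<noteq> b \<and> b \<noteq> c \<and> a \<noteq> c \<and>
      \<phi> {i, j} = {a, b} \<and> \<phi> {j, k} = {b, c} \<and> \<phi> {i, k} = {a, c}"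
    using nt unfolding triangle_preserving_def by blast
  have "card (\<phi> {x, y}) = 2" if "x \<in> {1..n}" "y \<in> {1..n}" "x \<noteq> y" for x y
    using permutes_in_image[OF perm, of "{x, y}"] that
    by (simp add: doubleton_in_edges) (simp add: edges_def)
  moreover have "\<phi> {i, j} \<noteq> \<phi> {j, k}" "\<phi> {i, j} \<noteq> \<phi> {i, k}" "\<phi> {j, k} \<noteq> \<phi> {i, k}"
    using permutes_inj[OF perm] ijk by (auto simp: inj_eq doubleton_eq_iff)
  ultimately have "\<not> ((\<forall>v\<in>\<phi> {i, j}. v \<in> \<phi> {j, k} \<or> v \<in> \<phi> {i, k}) \<and>
      (\<forall>v\<in>\<phi> {j, k}. v \<in> \<phi> {i, j} \<or> v \<in> \<phi> {i, k}))"
    using three_edges_triangle[of "\<phi> {i, j}" "\<phi> {j, k}" "\<phi> {i, k}"] no ijk by blast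
  then show ?thesis
    using that[of i j k] that[of j k i] ijk by (auto simp: insert_commute)
qed

context quadratic_space
begin

lemma edge_distance_singleton: "edge_distance P {i} = 0"
  using edge_distance_doubleton[of P i i] by (simp add: sq_distance_def)

lemma edge_distance_perturbed:
  assumes "\<And>i. form (P i) u = 0"
  shows "edge_distance (\<lambda>i. P i + (s * x i) *s u) e =
    edge_distance P e + s\<^sup>2 * (form u u * square_gap x e)"
proof -
  have "form u (P i) = 0" for i using assms form_sym by metis
  with assms show ?thesis
    by (simp add: edge_distance_def sq_distance_def square_gap_def form_simps
        power2_eq_square algebra_simps)
qed

lemma edge_form_of_configuration:
  assumes "(\<Sum>i\<in>{1..n}. h i) = 0" "(\<Sum>i\<in>{1..n}. h' i) = 0"
  shows "edge_form n (edge_distance Q) h h' =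
    - 2 * form (\<Sum>i\<in>{1..n}. h i *s Q i) (\<Sum>j\<in>{1..n}. h' j *s Q j)"
proof -
  have "edge_distance Q {i, j} * h i * h' j =
      form (Q i) (Q i) * h i * h' j + form (Q j) (Q j) * h' j * h i
        + - 2 * (h i * (h' j * form (Q i) (Q j)))" for i j
    by (simp add: edge_distance_doubleton sq_distance_def form_simps form_sym algebra_simps)
  then have "edge_form n (edge_distance Q) h h' =
      (\<Sum>i\<in>{1..n}. \<Sum>j\<in>{1..n}. form (Q i) (Q i) * h i * h' j)
      + (\<Sum>i\<in>{1..n}. \<Sum>j\<in>{1..n}. form (Q j) (Q j) * h' j * h i)
      + (\<Sum>i\<in>{1..n}. \<Sum>j\<in>{1..n}. - 2 * (h i * (h' j * form (Q i) (Q j))))"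
    unfolding edge_form_def by (simp only: sum.distrib)
  also have "(\<Sum>i\<in>{1..n}. \<Sum>j\<in>{1..n}. form (Q i) (Q i) * h i * h' j) =
      (\<Sum>i\<in>{1..n}. form (Q i) (Q i) * h i) * (\<Sum>j\<in>{1..n}. h' j)"
    by (rule sum_product[symmetric])
  also have "(\<Sum>i\<in>{1..n}. \<Sum>j\<in>{1..n}. form (Q j) (Q j) * h' j * h i) =
      (\<Sum>j\<in>{1..n}. form (Q j) (Q j) * h' j) * (\<Sum>i\<in>{1..n}. h i)"
    by (subst sum.swap) (rule sum_product[symmetric])
  also have "(\<Sum>i\<in>{1..n}. \<Sum>j\<in>{1..n}. - 2 * (h i * (h' j * form (Q i) (Q j)))) =
      - 2 * form (\<Sum>i\<in>{1..n}. h i *s Q i) (\<Sum>j\<in>{1..n}. h' j *s Q j)"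
    by (subst form_sum_left) (simp add: form_sum_right form_scale_left form_scale_right
        sum_distrib_left mult.left_commute)
  finally show ?thesis
    using assms by simp
qed

text \<open>More than \<open>dimension\<close> vectors satisfy a linear relation, which is a kernel vector of their Gram matrix.\<close>
lemma det_gram_zero:
  assumes "dimension < k"
  shows "det (mat k k (\<lambda>(a, b). c * form (Y a) (Y b))) = 0"
proof -
  obtain bs where bs: "bij_betw bs {0..<dimension} Basis"
    using ex_bij_betw_nat_finite[OF finite_Basis] by (auto simp: dimension_def)
  obtain z where z: "\<exists>i<k. z i \<noteq> 0"
    and zr: "\<And>r. r < dimension \<Longrightarrow> (\<Sum>i<k. coord (Y i) (bs r) * z i) = 0"
    using underdetermined_system[OF assms, of "\<lambda>r i. coord (Y i) (bs r)"] by blast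
  have "coord (\<Sum>i<k. z i *s Y i) b = 0" if b: "b \<in> Basis" for b
  proof -
    obtain r where "r < dimension" "b = bs r"
      using bs b by (force simp: bij_betw_def)
    then show ?thesis
      using zr[of r]
      by (simp add: representation_sum independent_Basis span_Basis coord_scale mult.commute)
  qed
  then have Y0: "(\<Sum>i<k. z i *s Y i) = 0"
    using sum_coord[of "\<Sum>i<k. z i *s Y i"] by simp
  let ?M = "mat k k (\<lambda>(a, b). c * form (Y a) (Y b))"
  have "?M *\<^sub>v vec k z = 0\<^sub>v k"
  proof (rule eq_vecI)
    fix a assume a: "a < dim_vec (0\<^sub>v k :: 'a vec)"
    have "(?M *\<^sub>v vec k z) $ a = (\<Sum>b<k. c * form (Y a) (Y b) * z b)"
      using a by (simp add: scalar_prod_def atLeast0LessThan)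
    also have "\<dots> = c * form (Y a) (\<Sum>b<k. z b *s Y b)"
      by (simp add: form_sum_right form_scale_right sum_distrib_left mult_ac)
    finally show "(?M *\<^sub>v vec k z) $ a = 0\<^sub>v k $ a"
      using a by (simp add: Y0)
  qed simp
  moreover have "vec k z \<noteq> 0\<^sub>v k"
    using z by (metis index_vec index_zero_vec(1))
  ultimately show ?thesis
    using det_0_iff_vec_prod_zero_field[of ?M k] vec_carrier[of k z] mat_carrier by blast
qed

text \<open>
  Each direction of an orthogonal basis raises the rank of the rearranged distances by at least one,
  starting from rank \<open>2\<close> for the first direction. The rank is certified by vectors \<open>h a\<close> of coordinate sum
  zero. The points stay orthogonal to the directions not yet used, so that moving them along the next one
  changes the distances by a purely quadratic term (\<open>edge_distance_perturbed\<close>). The new vector \<open>h a\<close>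
  is a solution of \<open>k + 3 < n\<close> homogeneous linear equations in \<open>n\<close> unknowns.
\<close>
lemma twisted_rank_growth:
  assumes inf: "infinite (UNIV :: 'a set)"
    and perm: "\<phi> permutes edges n" and nt: "\<not> triangle_preserving n \<phi>"
    and n: "dimension + 2 \<le> n"
    and e: "\<And>i j. i < dimension \<Longrightarrow> j < dimension \<Longrightarrow> form (e i) (e j) = 0 \<longleftrightarrow> i \<noteq> j"
    and k: "Suc k \<le> dimension"
  shows "\<exists>h P. (\<forall>a<k + 2. (\<Sum>i\<in>{1..n}. h a i) = 0) \<and>
    (\<forall>i l. Suc k \<le> l \<longrightarrow> l < dimension \<longrightarrow> form (P i) (e l) = 0) \<and>
    det (mat (k + 2) (k + 2) (\<lambda>(a, b). edge_form n (edge_distance P \<circ> \<phi>) (h a) (h b))) \<noteq> 0"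
  using k
proof (induction k)
  case 0
  obtain i j k v where ijk: "i \<in> {1..n}" "j \<in> {1..n}" "k \<in> {1..n}" "i \<noteq> j" "j \<noteq> k" "i \<noteq> k"
    and v: "v \<in> \<phi> {i, j}" "v \<notin> \<phi> {j, k}" "v \<notin> \<phi> {i, k}"
    using not_triangle_preserving_witness[OF perm nt] by metis
  define P where "P i = (if i = v then e 0 else 0)" for i
  let ?D = "edge_distance P \<circ> \<phi>"
  have D: "?D {x, y} = (if v \<in> \<phi> {x, y} then form (e 0) (e 0) else 0)"
    if xy: "x \<in> {1..n}" "y \<in> {1..n}" "x \<noteq> y" for x y
  proof -
    have "\<phi> {x, y} \<in> edges n"
      using permutes_in_image[OF perm, of "{x, y}"] xy by (simp add: doubleton_in_edges)
    then obtain c d where "\<phi> {x, y} = {c, d}" "c \<noteq> d"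
      by (auto simp: edges_def card_2_iff)
    then show ?thesis
      by (auto simp: P_def edge_distance_doubleton sq_distance_def form_simps)
  qed
  have "\<phi> {x} = {x}" for x
    using permutes_not_in[OF perm, of "{x}"] by (simp add: edges_def)
  then have Dk: "?D {x, x} = 0" for x
    by (simp add: edge_distance_singleton)
  have Dij: "?D {i, j} = form (e 0) (e 0)" "?D {j, i} = form (e 0) (e 0)"
    using D[of i j] ijk v by (simp_all add: insert_commute)
  have Dik: "?D {i, k} = 0" "?D {k, i} = 0"
    using D[of i k] ijk v by (simp_all add: insert_commute)
  have Djk: "?D {j, k} = 0" "?D {k, j} = 0"
    using D[of j k] ijk v by (simp_all add: insert_commute)
  have "form (e 0) (e 0) \<noteq> 0"
    using e[of 0 0] 0 by simp
  \<comment> \<open>On these two vectors the form has zero diagonal: it sees the value of \<open>{i, j}\<close> only off the diagonal.\<close>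
  define h where "h a x = (of_bool (x = (if a = 0 then i else j)) - of_bool (x = k) :: 'a)" for a :: nat and x
  have h_sum: "(\<Sum>x\<in>{1..n}. h a x) = 0" for a
    using ijk by (simp add: h_def sum_subtractf of_bool_def)
  have ef: "edge_form n ?D (h a) (h b) =
      ?D {if a = 0 then i else j, if b = 0 then i else j} - ?D {if a = 0 then i else j, k}
      - (?D {k, if b = 0 then i else j} - ?D {k, k})" for a b
    unfolding h_def edge_form_diff_left edge_form_diff_right
    using ijk by (simp only: edge_form_delta split: if_split) simp
  have "det (mat 2 2 (\<lambda>(a, b). edge_form n ?D (h a) (h b))) \<noteq> 0"
    unfolding ef
    by (rule det_antidiagonal_nonzero)
      (use \<open>form (e 0) (e 0) \<noteq> 0\<close> Dij Dik Djk Dk in simp_all)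
  then have "(\<forall>a<0 + 2. (\<Sum>i\<in>{1..n}. h a i) = 0) \<and>
    (\<forall>i l. Suc 0 \<le> l \<longrightarrow> l < dimension \<longrightarrow> form (P i) (e l) = 0) \<and>
    det (mat (0 + 2) (0 + 2) (\<lambda>(a, b). edge_form n ?D (h a) (h b))) \<noteq> 0"
    using h_sum e 0 by (auto simp: P_def numeral_2_eq_2)
  then show ?case by blast
next
  case (Suc k)
  then have "Suc k \<le> dimension" by simp
  from Suc.IH[OF this] obtain h P where hs: "\<And>a. a < k + 2 \<Longrightarrow> (\<Sum>i\<in>{1..n}. h a i) = 0"
    and Pe: "\<And>i l. Suc k \<le> l \<Longrightarrow> l < dimension \<Longrightarrow> form (P i) (e l) = 0"
    and dt: "det (mat (k + 2) (k + 2)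
      (\<lambda>(a, b). edge_form n (edge_distance P \<circ> \<phi>) (h a) (h b))) \<noteq> 0"
    by blast
  let ?B = "edge_form n (edge_distance P \<circ> \<phi>)"
  \<comment> \<open>Orthogonality to the \<open>k + 2\<close> vectors found so far, and coordinate sum zero; the unknowns are counted from 0.\<close>
  define A where "A r i = (if r < k + 2 then
      (\<Sum>j\<in>{1..n}. edge_distance P (\<phi> {j, Suc i}) * h r j) else 1)" for r i
  have "k + 3 < n" using n Suc.prems by simp
  then obtain c where c: "\<exists>i<n. c i \<noteq> 0"
    and Ac: "\<And>r. r < k + 3 \<Longrightarrow> (\<Sum>i<n. A r i * c i) = 0"
    using underdetermined_system[of "k + 3" n A] by blast
  define g where "g i = c (i - 1)" for i
  have shift: "(\<Sum>i\<in>{1..n}. f i) = (\<Sum>i<n. f (Suc i))" for f :: "nat \<Rightarrow> 'a"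
    by (simp add: sum.atLeast1_atMost_eq)
  have g_sum: "(\<Sum>i\<in>{1..n}. g i) = 0"
    unfolding shift using Ac[of "k + 2"] by (simp add: g_def A_def)
  have g_orth: "?B (h r) g = 0" if r: "r < k + 2" for r
  proof -
    have "?B (h r) g = (\<Sum>i\<in>{1..n}. (\<Sum>j\<in>{1..n}. edge_distance P (\<phi> {j, i}) * h r j) * g i)"
      unfolding edge_form_def by (subst sum.swap) (simp add: sum_distrib_right)
    also have "\<dots> = (\<Sum>i<n. (\<Sum>j\<in>{1..n}. edge_distance P (\<phi> {j, Suc i}) * h r j) * g (Suc i))"
      by (rule shift)
    also have "\<dots> = (\<Sum>i<n. A r i * c i)"
      using r by (simp add: A_def g_def)
    finally show ?thesis using Ac[of r] r by simp
  qed
  obtain i0 where "i0 < n" "c i0 \<noteq> 0" using c by blast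
  then have "\<exists>i\<in>{1..n}. g i \<noteq> 0"
    by (intro bexI[of _ "Suc i0"]) (auto simp: g_def)
  then obtain x where x: "edge_form n (square_gap x \<circ> \<phi>) g g \<noteq> 0"
    using square_gap_detects[OF two_nonzero perm g_sum] by blast
  define u where "u = e (Suc k)"
  have uu: "form u u \<noteq> 0"
    using e Suc.prems by (simp add: u_def)
  define h' where "h' = h(k + 2 := g)"
  let ?C = "edge_form n (\<lambda>e. form u u * square_gap x (\<phi> e))"
  have C: "?C f f' = form u u * edge_form n (square_gap x \<circ> \<phi>) f f'" for f f'
    by (simp add: edge_form_def sum_distrib_left mult.assoc)
  obtain s where s: "det (mat (Suc (k + 2)) (Suc (k + 2))
      (\<lambda>(a, b). ?B (h' a) (h' b) + s\<^sup>2 * ?C (h' a) (h' b))) \<noteq> 0"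
  proof (rule det_perturbation_nonzero[OF inf, where k = "k + 2"
        and A = "\<lambda>a b. ?B (h' a) (h' b)" and C = "\<lambda>a b. ?C (h' a) (h' b)"])
    have "mat (k + 2) (k + 2) (\<lambda>(a, b). ?B (h' a) (h' b)) =
        mat (k + 2) (k + 2) (\<lambda>(a, b). ?B (h a) (h b))"
      by (intro eq_matI) (auto simp: h'_def)
    then show "det (mat (k + 2) (k + 2) (\<lambda>(a, b). ?B (h' a) (h' b))) \<noteq> 0"
      using dt by simp
    show "?B (h' i) (h' (k + 2)) = 0" if "i < k + 2" for i
      using g_orth[OF that] that by (simp add: h'_def)
    show "?B (h' (k + 2)) (h' j) = 0" if "j < k + 2" for j
      using g_orth[OF that] that edge_form_commute[of n _ g] by (simp add: h'_def)
    show "?C (h' (k + 2)) (h' (k + 2)) \<noteq> 0"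
      using x uu by (simp add: h'_def C)
  qed
  define R where "R i = P i + (s * x i) *s u" for i
  have "edge_distance R e = edge_distance P e + s\<^sup>2 * (form u u * square_gap x e)" for e
    unfolding R_def using Pe Suc.prems by (intro edge_distance_perturbed) (simp add: u_def)
  then have R: "edge_form n (edge_distance R \<circ> \<phi>) f f' = ?B f f' + s\<^sup>2 * ?C f f'" for f f'
    using edge_form_lincomb[of n "edge_distance P \<circ> \<phi>" "s\<^sup>2" "\<lambda>e. form u u * square_gap x (\<phi> e)" f f']
    by (simp add: comp_def)
  have "(\<forall>a<Suc k + 2. (\<Sum>i\<in>{1..n}. h' a i) = 0)"
    using hs g_sum by (simp add: h'_def less_Suc_eq)
  moreover have "\<forall>i l. Suc (Suc k) \<le> l \<longrightarrow> l < dimension \<longrightarrow> form (R i) (e l) = 0"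
    using Pe e Suc.prems by (auto simp: R_def u_def form_simps)
  moreover have "det (mat (Suc k + 2) (Suc k + 2)
      (\<lambda>(a, b). edge_form n (edge_distance R \<circ> \<phi>) (h' a) (h' b))) \<noteq> 0"
    using s unfolding R by simp
  ultimately show ?case by blast
qed

end

section \<open>Generic configurations\<close>

text \<open>
  With at most three points, a vertex lying on only one of three edges would leave room for only one
  further edge.
\<close>
lemma triangle_preserving_few_points:
  assumes perm: "\<phi> permutes edges n" and n: "n \<le> 3"
  shows "triangle_preserving n \<phi>"
proof (rule ccontr)
  assume "\<not> ?thesis"
  then obtain i j k v where ijk: "i \<in> {1..n}" "j \<in> {1..n}" "k \<in> {1..n}" "i \<noteq> j" "j \<noteq> k" "i \<noteq> k"
    and v: "v \<in> \<phi> {i, j}" "v \<notin> \<phi> {j, k}" "v \<notin> \<phi> {i, k}"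
    using not_triangle_preserving_witness[OF perm] by metis
  have edge: "\<phi> {x, y} \<in> edges n" if "x \<in> {1..n}" "y \<in> {1..n}" "x \<noteq> y" for x y
    using that permutes_in_image[OF perm, of "{x, y}"] by (simp add: doubleton_in_edges)
  have "v \<in> {1..n}"
    using edge[of i j] ijk v(1) by (auto simp: edges_def)
  then have "card ({1..n} - {v}) \<le> 2"
    using n by simp
  then have "e = {1..n} - {v}" if "e \<in> edges n" "v \<notin> e" for e
    using that by (intro card_seteq) (auto simp: edges_def)
  then have "\<phi> {j, k} = \<phi> {i, k}"
    using edge[of j k] edge[of i k] v ijk by metis
  then show False
    using permutes_inj[OF perm] ijk by (auto simp: inj_eq doubleton_eq_iff)
qed

context quadratic_space
begin

lemma polyfun_edge_distance:
  assumes "{i, j} \<subseteq> {1..n}"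
  shows "polyfun n (\<lambda>P. edge_distance P {i, j})"
  using assms unfolding edge_distance_doubleton sq_distance_def
  by (intro polyfun_form polyvec_diff polyvec_point) auto

lemma polyfun_twisted_det:
  assumes perm: "\<phi> permutes edges n"
  shows "polyfun n (\<lambda>P. det (mat k k (\<lambda>(a, b). edge_form n (edge_distance P \<circ> \<phi>) (h a) (h b))))"
proof -
  have "polyfun n (\<lambda>P. edge_distance P (\<phi> {i, j}))" if ij: "i \<in> {1..n}" "j \<in> {1..n}" for i j
  proof -
    obtain c d where cd: "\<phi> {i, j} = {c, d}"
      using permuted_edge_doubleton[OF perm ij] by blast
    have "\<phi> {i, j} \<subseteq> {1..n}"
    proof (cases "i = j")
      case True
      then show ?thesis
        using permutes_not_in[OF perm, of "{i, j}"] ij by (simp add: edges_def)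
    next
      case False
      then show ?thesis
        using permutes_in_image[OF perm, of "{i, j}"] ij
        by (simp add: doubleton_in_edges) (simp add: edges_def)
    qed
    then show ?thesis
      using polyfun_edge_distance[of c d n] cd by simp
  qed
  then show ?thesis
    unfolding edge_form_def comp_def
    by (intro polyfun_det polyfun_sum polyfun.mult polyfun.const) auto
qed

text \<open>
  If the rearranged distances of \<open>P\<close> are the distances of some \<open>Q\<close>, they give a Gram matrix
  of vectors in an \<open>m\<close>-dimensional space.
\<close>
lemma twisted_det_vanishes:
  assumes perm: "\<phi> permutes edges n"
    and dist: "\<And>e. e \<in> edges n \<Longrightarrow> edge_distance Q e = edge_distance P (\<phi> e)"
    and h: "\<And>a. a < k \<Longrightarrow> (\<Sum>i\<in>{1..n}. h a i) = 0" and k: "dimension < k"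
  shows "det (mat k k (\<lambda>(a, b). edge_form n (edge_distance P \<circ> \<phi>) (h a) (h b))) = 0"
proof -
  let ?Y = "\<lambda>a. \<Sum>i\<in>{1..n}. h a i *s Q i"
  have ef: "edge_form n (edge_distance P \<circ> \<phi>) f f' = edge_form n (edge_distance Q) f f'" for f f'
  proof (rule edge_form_cong)
    fix i j assume ij: "i \<in> {1..n}" "j \<in> {1..n}"
    show "(edge_distance P \<circ> \<phi>) {i, j} = edge_distance Q {i, j}"
    proof (cases "i = j")
      case True
      then have "\<phi> {i, j} = {i, j}"
        using permutes_not_in[OF perm] by (simp add: edges_def)
      with True show ?thesis by (simp add: edge_distance_singleton)
    next
      case False
      then show ?thesis using dist ij by (simp add: doubleton_in_edges)
    qed
  qed
  have "mat k k (\<lambda>(a, b). edge_form n (edge_distance P \<circ> \<phi>) (h a) (h b)) =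
      mat k k (\<lambda>(a, b). - 2 * form (?Y a) (?Y b))"
    unfolding ef by (intro eq_matI) (simp_all add: edge_form_of_configuration[OF h h])
  then show ?thesis
    using det_gram_zero[OF k, of "- 2" ?Y] by simp
qed

lemma polyfun_frame_minor:
  assumes "r < n"
  shows "polyfun n (frame_minor r)"
proof -
  have "polyfun n (\<lambda>P. orth_minor (map (\<lambda>X. X P) (map (\<lambda>i P. P (i + 2) - P 1) [0..<r])))"
    using assms by (intro polyfun_orth_minor) (auto intro!: polyvec_diff polyvec_point)
  then show ?thesis
    by (simp add: frame_minor_def[abs_def] comp_def)
qed

text \<open>The origin followed by vectors of an orthogonal basis is a witness.\<close>
lemma frame_minor_nonzero:
  assumes "r \<le> dimension"
  shows "\<exists>P. frame_minor r P \<noteq> 0"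
proof -
  obtain e where e: "\<forall>i<dimension. \<forall>j<dimension. form (e i) (e j) = 0 \<longleftrightarrow> i \<noteq> j"
    using orthogonal_basis_exists by blast
  define P where "P i = (if i = 1 then 0 else e (i - 2))" for i :: nat
  have "frame_minor r P \<noteq> 0"
    unfolding frame_minor_def
    by (rule orth_minor_orthogonal) (use e assms in \<open>simp add: P_def\<close>)
  then show ?thesis by blast
qed

text \<open>
  Once the permutation of edges is known to come from a permutation \<open>\<pi>\<close> of points, it is \<open>Q\<close> that is
  relabelled, by the inverse of \<open>\<pi>\<close>: the condition needed for congruence depends on the labelling, and it
  is known for \<open>P\<close> only as given.
\<close>
lemma reconstructible_if_nonvanishing:
  assumes minor: "frame_minor (min dimension (n - 1)) P \<noteq> 0"
    and twisted: "\<And>\<phi>. \<phi> permutes edges n \<Longrightarrow> \<not> triangle_preserving n \<phi> \<Longrightarrow>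
      \<exists>h. (\<forall>a<dimension + 1. (\<Sum>i\<in>{1..n}. h a i) = 0) \<and>
        det (mat (dimension + 1) (dimension + 1)
          (\<lambda>(a, b). edge_form n (edge_distance P \<circ> \<phi>) (h a) (h b))) \<noteq> 0"
  shows "reconstructible scale form n P"
  unfolding reconstructible_def
proof (intro allI impI)
  fix Q assume "distance_poly form n Q = distance_poly form n P"
  then obtain \<phi> where perm: "\<phi> permutes edges n"
    and dist: "\<And>e. e \<in> edges n \<Longrightarrow> edge_distance Q e = edge_distance P (\<phi> e)"
    using permutation_if_linear_products_eq[OF finite_edges[of n]] unfolding distance_poly_edges
    by metis
  have "triangle_preserving n \<phi>"
  proof (rule ccontr)
    assume "\<not> triangle_preserving n \<phi>"
    then obtain h where "\<forall>a<dimension + 1. (\<Sum>i\<in>{1..n}. h a i) = 0"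
      "det (mat (dimension + 1) (dimension + 1)
          (\<lambda>(a, b). edge_form n (edge_distance P \<circ> \<phi>) (h a) (h b))) \<noteq> 0"
      using twisted[OF perm] by blast
    then show False
      using twisted_det_vanishes[OF perm dist, of "dimension + 1" h] by simp
  qed
  then obtain \<pi> where \<pi>: "\<pi> permutes {1..n}"
    and \<phi>: "\<And>i j. i \<in> {1..n} \<Longrightarrow> j \<in> {1..n} \<Longrightarrow> i \<noteq> j \<Longrightarrow> \<phi> {i, j} = {\<pi> i, \<pi> j}"
    using triangle_preserving_induced[OF perm] by blast
  obtain \<sigma> where \<sigma>: "\<sigma> permutes {1..n}" "\<And>i. \<pi> (\<sigma> i) = i" "\<And>i. \<sigma> (\<pi> i) = i"
    using permutes_inv[OF \<pi>] permutes_inverses[OF \<pi>] by blast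
  have "sq_distance form P i j = sq_distance form (Q \<circ> \<sigma>) i j"
    if ij: "i \<in> {1..n}" "j \<in> {1..n}" for i j
  proof (cases "i = j")
    case False
    have range: "\<sigma> i \<in> {1..n}" "\<sigma> j \<in> {1..n}"
      using ij permutes_in_image[OF \<sigma>(1)] by blast+
    moreover have "\<sigma> i \<noteq> \<sigma> j" using False \<sigma>(2) by metis
    ultimately have "edge_distance Q {\<sigma> i, \<sigma> j} = edge_distance P {i, j}"
      using dist[of "{\<sigma> i, \<sigma> j}"] \<phi>[of "\<sigma> i" "\<sigma> j"] \<sigma>(2) by (simp only: doubleton_in_edges) simp
    then show ?thesis
      by (simp add: edge_distance_doubleton sq_distance_def)
  qed (simp add: sq_distance_def)
  then obtain g where g: "g \<in> affine_orthogonal_group scale form"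
    and gP: "\<And>i. i \<in> {1..n} \<Longrightarrow> g (P i) = Q (\<sigma> i)"
    using congruent_if_distances_equal[OF minor, of "Q \<circ> \<sigma>"] by auto
  have "g (P (\<pi> i)) = Q i" if "i \<in> {1..n}" for i
    using gP[of "\<pi> i"] permutes_in_image[OF \<pi>, of i] that \<sigma>(3) by simp
  then show "\<exists>\<pi> g. \<pi> permutes {1..n} \<and> g \<in> affine_orthogonal_group scale form \<and>
      (\<forall>i\<in>{1..n}. g (P (\<pi> i)) = Q i)"
    using \<pi> g by blast
qed

text \<open>
  The polynomial is the product of the \<open>frame_minor\<close> of the configuration and one determinant for each
  permutation of the edges that does not preserve triangles.
\<close>
lemma generic_reconstructibility_infinite:
  assumes inf: "infinite (UNIV :: 'a set)" and dim: "dimension > 0"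
    and n: "n > 0" "n \<le> 3 \<or> n \<ge> dimension + 2"
  shows "\<exists>f \<in> configuration_polys n Basis. f \<noteq> 0 \<and>
    (\<forall>P. eval_at_configuration scale Basis f P \<noteq> 0 \<longrightarrow> reconstructible scale form n P)"
proof -
  define \<Phi> where "\<Phi> = {\<phi>. \<phi> permutes edges n \<and> \<not> triangle_preserving n \<phi>}"
  let ?m = "dimension + 1"
  let ?det = "\<lambda>\<phi> h P. det (mat ?m ?m (\<lambda>(a, b). edge_form n (edge_distance P \<circ> \<phi>) (h a) (h b)))"
  have "\<exists>h. (\<forall>a<?m. (\<Sum>i\<in>{1..n}. h a i) = 0) \<and> (\<exists>P. ?det \<phi> h P \<noteq> 0)" if \<phi>: "\<phi> \<in> \<Phi>" for \<phi>
  proof -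
    have perm: "\<phi> permutes edges n" and nt: "\<not> triangle_preserving n \<phi>"
      using \<phi> by (auto simp: \<Phi>_def)
    have "\<not> n \<le> 3"
      using nt triangle_preserving_few_points[OF perm] by blast
    then have n2: "dimension + 2 \<le> n" using n by simp
    obtain e where e: "\<forall>i<dimension. \<forall>j<dimension. form (e i) (e j) = 0 \<longleftrightarrow> i \<noteq> j"
      using orthogonal_basis_exists by blast
    have k: "Suc (dimension - 1) \<le> dimension" "dimension - 1 + 2 = ?m"
      using dim by auto
    show ?thesis
      using twisted_rank_growth[OF inf perm nt n2, of e "dimension - 1"] e k unfolding k(2) by blast
  qed
  then obtain h where h: "\<And>\<phi> a. \<phi> \<in> \<Phi> \<Longrightarrow> a < ?m \<Longrightarrow> (\<Sum>i\<in>{1..n}. h \<phi> a i) = 0"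
    and hP: "\<And>\<phi>. \<phi> \<in> \<Phi> \<Longrightarrow> \<exists>P. ?det \<phi> (h \<phi>) P \<noteq> 0"
    by metis
  \<comment> \<open>The index \<open>None\<close> stands for the congruence condition.\<close>
  define G where "G \<phi> = (case \<phi> of None \<Rightarrow> frame_minor (min dimension (n - 1))
    | Some \<phi> \<Rightarrow> ?det \<phi> (h \<phi>))" for \<phi>
  let ?I = "insert None (Some ` \<Phi>)"
  have fin: "finite ?I"
    using finite_permutations[OF finite_edges[of n]] by (simp add: \<Phi>_def)
  have poly: "polyfun n (G i)" if "i \<in> ?I" for i
    using that n(1) polyfun_twisted_det
    by (auto simp: G_def \<Phi>_def intro!: polyfun_frame_minor)
  have "\<exists>P. G i P \<noteq> 0" if "i \<in> ?I" for i
    using that frame_minor_nonzero[of "min dimension (n - 1)"] hP by (auto simp: G_def)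
  then obtain P0 where P0: "\<forall>i\<in>?I. G i P0 \<noteq> 0"
    using polyfun_common_nonzero[OF inf fin, of n G] poly by blast
  have "polyfun n (\<lambda>P. \<Prod>i\<in>?I. G i P)"
    by (rule polyfun_prod) (rule poly)
  then obtain f where f: "f \<in> configuration_polys n Basis"
    and eval: "\<And>P. eval_at_configuration scale Basis f P = (\<Prod>i\<in>?I. G i P)"
    using polyfun_eq_eval by blast
  have "f \<noteq> 0"
  proof
    assume "f = 0"
    then have "(\<Prod>i\<in>?I. G i P0) = 0"
      using eval[of P0] by (simp add: eval_at_configuration_def)
    then show False using P0 fin by (simp only: prod_zero_iff) blast
  qed
  moreover have "reconstructible scale form n P" if nz: "eval_at_configuration scale Basis f P \<noteq> 0" for P
  proof (rule reconstructible_if_nonvanishing)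
    have G: "G i P \<noteq> 0" if "i \<in> ?I" for i
      using nz that fin unfolding eval by (simp only: prod_zero_iff) blast
    show "frame_minor (min dimension (n - 1)) P \<noteq> 0"
      using G[of None] by (simp add: G_def)
    show "\<exists>h. (\<forall>a<?m. (\<Sum>i\<in>{1..n}. h a i) = 0) \<and> ?det \<phi> h P \<noteq> 0"
      if \<phi>: "\<phi> permutes edges n" "\<not> triangle_preserving n \<phi>" for \<phi>
    proof -
      have "\<phi> \<in> \<Phi>" using \<phi> by (simp add: \<Phi>_def)
      then have "?det \<phi> (h \<phi>) P \<noteq> 0"
        using G[of "Some \<phi>"] by (simp add: G_def)
      then show ?thesis using h[OF \<open>\<phi> \<in> \<Phi>\<close>] by blast
    qed
  qed
  ultimately show ?thesis using f by blast
qed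

text \<open>
  There are finitely many functions on a finite field, so two different powers of a coordinate are
  equal as functions; their difference is a non-zero polynomial.
\<close>
lemma vanishing_polynomial_finite_field:
  assumes fin: "finite (UNIV :: 'a set)" and b: "b \<in> Basis" and n: "n > 0"
  shows "\<exists>f \<in> configuration_polys n Basis. f \<noteq> 0 \<and>
    (\<forall>P. eval_at_configuration scale Basis f P = 0)"
proof -
  have "finite (range (\<lambda>k t. t ^ k :: 'a))"
    by (rule finite_subset[OF _ finite_set_of_finite_funs[OF fin fin, of undefined]]) auto
  then have "\<not> inj (\<lambda>k t. t ^ k :: 'a)"
    using finite_imageD by (metis infinite_UNIV_nat)
  then obtain k l where kl: "k \<noteq> l" "(\<lambda>t. t ^ k :: 'a) = (\<lambda>t. t ^ l)"
    by (auto simp: inj_def)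
  let ?x = "\<lambda>k. Poly_Mapping.single (1 :: nat, b) k"
  define f :: "(nat \<times> 'v, 'a) mpoly"
    where "f = Poly_Mapping.single (?x k) 1 + Poly_Mapping.single (?x l) (- 1)"
  have "?x k \<noteq> ?x l"
    using kl(1) by (metis lookup_single_eq)
  then have "Poly_Mapping.lookup f (?x k) = 1"
    by (simp add: f_def lookup_add lookup_single)
  then have "f \<noteq> 0" by auto
  moreover have "f \<in> configuration_polys n Basis"
    using b n mpoly_vars_add[of "Poly_Mapping.single (?x k) 1" "Poly_Mapping.single (?x l) (- 1 :: 'a)"]
    by (auto simp: configuration_polys_def f_def mpoly_vars_def split: if_splits)
  moreover have "eval_at_configuration scale Basis f P = 0" for P
  proof -
    have "monomial_eval v (?x j) = v (1, b) ^ j" for v :: "nat \<times> 'v \<Rightarrow> 'a" and j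
      by (simp add: monomial_eval_def)
    then show ?thesis
      using fun_cong[OF kl(2)]
      by (simp add: eval_at_configuration_def f_def mpoly_eval_add mpoly_eval_single)
  qed
  ultimately show ?thesis by blast
qed

lemma reconstructible_zero_space:
  assumes "Basis = {}"
  shows "reconstructible scale form n P"
proof -
  have "x = 0" for x :: 'v
    using sum_coord[of x] assms by simp
  then have "g x = y" for g :: "'v \<Rightarrow> 'v" and x y
    by metis
  then show ?thesis
    unfolding reconstructible_def
    using permutes_id affine_orthogonal_translation by blast
qed

lemma generic_reconstructibility:
  assumes n: "n > 0" "n \<le> 3 \<or> n \<ge> dimension + 2"
  shows "\<exists>f \<in> configuration_polys n Basis. f \<noteq> 0 \<and>
    (\<forall>P. eval_at_configuration scale Basis f P \<noteq> 0 \<longrightarrow> reconstructible scale form n P)"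
proof (cases "Basis = {}")
  case True
  have "Poly_Mapping.single 0 1 \<in> configuration_polys n Basis"
    by (simp add: configuration_polys_def mpoly_vars_def)
  moreover have "Poly_Mapping.single 0 1 \<noteq> (0 :: (nat \<times> 'v, 'a) mpoly)"
    by (metis lookup_single_eq lookup_zero one_neq_zero)
  ultimately show ?thesis
    using reconstructible_zero_space[OF True] by blast
next
  case False
  show ?thesis
  proof (cases "finite (UNIV :: 'a set)")
    case True
    obtain b where "b \<in> Basis" using False by blast
    then show ?thesis
      using vanishing_polynomial_finite_field[OF True _ n(1)] by metis
  next
    case inf: False
    have "dimension > 0"
      using False by (simp add: dimension_def card_gt_0_iff finite_Basis)
    then show ?thesis
      using generic_reconstructibility_infinite[OF inf _ n] by blast
  qed
qed

end

theorem theorem1p6: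
  fixes scale :: "'a::field \<Rightarrow> 'v::ab_group_add \<Rightarrow> 'v"
    and B :: "'v set"
    and form :: "'v \<Rightarrow> 'v \<Rightarrow> 'a"
    and m n :: nat
  assumes "CHAR('a) \<noteq> 2"
    and "finite_dimensional_vector_space scale B"
    and "vector_space.dim scale (UNIV :: 'v set) = m"
    and "symmetric_bilinear_form scale form"
    and "nondegenerate_form form"
    and "n > 0"
    and "n \<le> 3 \<or> n \<ge> m + 2"
  shows "\<exists>f \<in> configuration_polys n B. f \<noteq> 0 \<and>
    (\<forall>P. eval_at_configuration scale B f P \<noteq> 0 \<longrightarrow> reconstructible scale form n P)"
proof -
  have "(2::'a) \<noteq> 0"
  proof
    assume "(2::'a) = 0"
    then have "CHAR('a) dvd 2"
      using of_nat_eq_0_iff_char_dvd[of 2, where 'a = 'a] by simp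
    then have "CHAR('a) = 1"
      using assms(1) by (metis dvd_antisym dvd_1_left nat_dvd_not_less two_is_prime_nat prime_nat_iff)
    then show False
      using of_nat_CHAR[where 'a = 'a] by simp
  qed
  then interpret quadratic_space scale B form
    using assms(2,4,5) by (simp add: quadratic_space_def quadratic_space_axioms_def)
  show ?thesis
    using generic_reconstructibility[of n] assms(3,6,7) by (simp add: dimension_def)
qed

end
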